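(* Let $W_1,\dots,W_k$ be subgroups of $S_d$, let $\chi_m\colon W_m\to K$ be a one-dimensional character of $W_m$, and let $I_m$ be a left transversal of $W_m$ in $S_d$, $m=1,\dots,k$. The tensor product $$ \mathrm{ind}_{W_1}^{S_d}(\chi_1)\otimes_K \mathrm{ind}_{W_2}^{S_d}(\chi_2)\otimes_K\cdots\otimes_K \mathrm{ind}_{W_k}^{S_d}(\chi_k) $$ is a monomial $K$-linear representation of $S_d$ with basis $(e_i=e_{i_1}\otimes\cdots\otimes e_{i_k})_{i=(i_1,\dots,i_k)\in I}$, $I=I_1\times\cdots\times I_k$, the action of $S_d$ being given by the rule $$ \zeta e_i=\beta_i(\zeta)\,e_{s(\zeta)(i)},\qquad \zeta\in S_d,\ i\in I, $$ where $\beta_i(\zeta)=\beta^{(1)}_{i_1}(\zeta)\cdots\beta^{(k)}_{i_k}(\zeta)$.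
   Context: $K$ is an algebraically closed field of characteristic zero; $d,k\ge1$; $S_d$ is the symmetric group. A one-dimensional character of a group $W$ is a homomorphism $\chi\colon W\to K^*$, and $K_\chi$ is $K$ with $W$ acting by $\sigma c=\chi(\sigma)c$. For $W\le S_d$, $\mathrm{ind}_W^{S_d}(\chi)=KS_d\otimes_{KW}K_\chi$; for a left transversal $I_m$ of $W_m$ the elements $e_i=i\otimes1$, $i\in I_m$, form a basis of $\mathrm{ind}_{W_m}^{S_d}(\chi_m)$. The homomorphism $s_m\colon S_d\to S(I_m)$ is determined by: $s_m(\zeta)(i)$ is the unique $j\in I_m$ with $j^{-1}\zeta i\in W_m$; and $\beta^{(m)}_i(\zeta)=\chi_m\bigl((s_m(\zeta)(i))^{-1}\zeta i\bigr)$ for $i\in I_m$. The action of $S_d$ on $I$ is $s(\zeta)(i_1,\dots,i_k)=(s_1(\zeta)(i_1),\dots,s_k(\zeta)(i_k))$. The tensor product carries the diagonal $S_d$-action. A representation is monomial (with respect to a basis) if each group element sends each basis vector to a nonzero scalar multiple of a basis vector. *)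

theory Defs
  imports
    "HOL-Computational_Algebra.Polynomial"
    "HOL-Algebra.Sym_Groups"
    "HOL-Algebra.AbelCoset"
    "HOL-Algebra.Left_Coset"
    "HOL-Algebra.Group_Action"
    "Jordan_Normal_Form.VS_Connect"
begin

text \<open>
  The ground field is a type \<open>'k\<close>, seen as a ring record via \<open>class_ring\<close>; vector spaces over
  it are records of type \<open>('k, 'v) module\<close> satisfying \<open>vectorspace class_ring\<close>.
  The fields \<open>mult\<close> and \<open>one\<close> of these records play no role for vector spaces and are left
  undefined, except in \<open>group_algebra\<close>, which uses them for the product of the algebra.
\<close>

definition free_space :: "'x set \<Rightarrow> ('k::field, 'x \<Rightarrow> 'k) module" where
  "free_space X =
    \<lparr>carrier = {f. finite {x. f x \<noteq> 0} \<and> {x. f x \<noteq> 0} \<subseteq> X},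
     mult = undefined, one = undefined,
     zero = (\<lambda>x. 0), add = (\<lambda>f g x. f x + g x), smult = (\<lambda>c f x. c * f x)\<rparr>"

definition single :: "'x \<Rightarrow> 'x \<Rightarrow> 'k::field" where
  "single x = (\<lambda>y. if y = x then 1 else 0)"

text \<open>The linear extension of a map \<open>\<phi>\<close> between the basis sets of two free spaces.\<close>

definition free_map :: "('x \<Rightarrow> 'y) \<Rightarrow> ('x \<Rightarrow> 'k::field) \<Rightarrow> ('y \<Rightarrow> 'k)" where
  "free_map \<phi> f = (\<lambda>y. \<Sum>x\<in>{x. f x \<noteq> 0 \<and> \<phi> x = y}. f x)"

definition quot_space ::
  "('k::field, 'v) module \<Rightarrow> 'v set \<Rightarrow> ('k, 'v set) module" where
  "quot_space V U =
    \<lparr>carrier = a_rcosets\<^bsub>V\<^esub> U, mult = undefined, one = undefined,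
     zero = U, add = (<+>\<^bsub>V\<^esub>), smult = (\<lambda>c C. \<Union>v\<in>C. U +>\<^bsub>V\<^esub> (c \<odot>\<^bsub>V\<^esub> v))\<rparr>"

text \<open>
  The endomorphism of \<open>V / U\<close> induced by a linear endomorphism \<open>T\<close> of \<open>V\<close> preserving \<open>U\<close>:
  the union below is then over equal cosets.
\<close>

definition quot_map ::
  "('k::field, 'v) module \<Rightarrow> 'v set \<Rightarrow> ('v \<Rightarrow> 'v) \<Rightarrow> 'v set \<Rightarrow> 'v set" where
  "quot_map V U T = (\<lambda>C\<in>carrier (quot_space V U). \<Union>v\<in>C. U +>\<^bsub>V\<^esub> T v)"

text \<open>
  For a \<open>K\<close>-algebra with underlying set \<open>A\<close>, a right module \<open>M\<close> (action \<open>r x a\<close>) and a left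
  module \<open>N\<close> (action \<open>l a y\<close>), the tensor product over \<open>A\<close> is the free space on \<open>M \<times> N\<close>
  modulo the \<open>K\<close>-bilinearity relations and the relations \<open>x a \<otimes> y = x \<otimes> a y\<close>.
\<close>

definition bal_rels ::
  "'a set \<Rightarrow> ('k::field, 'm) module \<Rightarrow> ('m \<Rightarrow> 'a \<Rightarrow> 'm) \<Rightarrow> ('k, 'n) module \<Rightarrow> ('a \<Rightarrow> 'n \<Rightarrow> 'n)
    \<Rightarrow> ('m \<times> 'n \<Rightarrow> 'k) set" where
  "bal_rels A M r N l =
     {single (x \<oplus>\<^bsub>M\<^esub> x', y) - single (x, y) - single (x', y) | x x' y.
        x \<in> carrier M \<and> x' \<in> carrier M \<and> y \<in> carrier N}
   \<union> {single (x, y \<oplus>\<^bsub>N\<^esub> y') - single (x, y) - single (x, y') | x y y'.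
        x \<in> carrier M \<and> y \<in> carrier N \<and> y' \<in> carrier N}
   \<union> {single (c \<odot>\<^bsub>M\<^esub> x, y) - (\<lambda>z. c * single (x, y) z) | c x y.
        x \<in> carrier M \<and> y \<in> carrier N}
   \<union> {single (x, c \<odot>\<^bsub>N\<^esub> y) - (\<lambda>z. c * single (x, y) z) | c x y.
        x \<in> carrier M \<and> y \<in> carrier N}
   \<union> {single (r x a, y) - single (x, l a y) | x a y.
        x \<in> carrier M \<and> a \<in> A \<and> y \<in> carrier N}"

definition bal_null ::
  "'a set \<Rightarrow> ('k::field, 'm) module \<Rightarrow> ('m \<Rightarrow> 'a \<Rightarrow> 'm) \<Rightarrow> ('k, 'n) module \<Rightarrow> ('a \<Rightarrow> 'n \<Rightarrow> 'n)
    \<Rightarrow> ('m \<times> 'n \<Rightarrow> 'k) set" where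
  "bal_null A M r N l =
     LinearCombinations.module.span class_ring (free_space (carrier M \<times> carrier N))
       (bal_rels A M r N l)"

definition bal_tensor ::
  "'a set \<Rightarrow> ('k::field, 'm) module \<Rightarrow> ('m \<Rightarrow> 'a \<Rightarrow> 'm) \<Rightarrow> ('k, 'n) module \<Rightarrow> ('a \<Rightarrow> 'n \<Rightarrow> 'n)
    \<Rightarrow> ('k, ('m \<times> 'n \<Rightarrow> 'k) set) module" where
  "bal_tensor A M r N l =
     quot_space (free_space (carrier M \<times> carrier N)) (bal_null A M r N l)"

text \<open>
  The tensor product over the ground field of a whole family is formed at once, by the universal
  multilinear map, rather than by iterating a binary product.
\<close>

definition tensor_rels ::
  "'i set \<Rightarrow> ('i \<Rightarrow> ('k::field, 'v) module) \<Rightarrow> (('i \<Rightarrow> 'v) \<Rightarrow> 'k) set" where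
  "tensor_rels J V =
     {single (v(j := x \<oplus>\<^bsub>V j\<^esub> y)) - single (v(j := x)) - single (v(j := y)) | v j x y.
        v \<in> (\<Pi>\<^sub>E j\<in>J. carrier (V j)) \<and> j \<in> J \<and> x \<in> carrier (V j) \<and> y \<in> carrier (V j)}
   \<union> {single (v(j := c \<odot>\<^bsub>V j\<^esub> x)) - (\<lambda>z. c * single (v(j := x)) z) | v j c x.
        v \<in> (\<Pi>\<^sub>E j\<in>J. carrier (V j)) \<and> j \<in> J \<and> x \<in> carrier (V j)}"

definition tensor_null ::
  "'i set \<Rightarrow> ('i \<Rightarrow> ('k::field, 'v) module) \<Rightarrow> (('i \<Rightarrow> 'v) \<Rightarrow> 'k) set" where
  "tensor_null J V =
     LinearCombinations.module.span class_ring (free_space (\<Pi>\<^sub>E j\<in>J. carrier (V j)))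
       (tensor_rels J V)"

definition tensor_space ::
  "'i set \<Rightarrow> ('i \<Rightarrow> ('k::field, 'v) module) \<Rightarrow> ('k, (('i \<Rightarrow> 'v) \<Rightarrow> 'k) set) module" where
  "tensor_space J V =
     quot_space (free_space (\<Pi>\<^sub>E j\<in>J. carrier (V j))) (tensor_null J V)"

definition pure_tensor ::
  "'i set \<Rightarrow> ('i \<Rightarrow> ('k::field, 'v) module) \<Rightarrow> ('i \<Rightarrow> 'v) \<Rightarrow> (('i \<Rightarrow> 'v) \<Rightarrow> 'k) set" where
  "pure_tensor J V v =
     a_r_coset (free_space (\<Pi>\<^sub>E j\<in>J. carrier (V j))) (tensor_null J V) (single (restrict v J))"

text \<open>The diagonal action, where \<open>\<rho> j\<close> is the action on the factor \<open>V j\<close>.\<close>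

definition tensor_action ::
  "'i set \<Rightarrow> ('i \<Rightarrow> ('k::field, 'v) module) \<Rightarrow> ('i \<Rightarrow> 'g \<Rightarrow> 'v \<Rightarrow> 'v)
    \<Rightarrow> 'g \<Rightarrow> (('i \<Rightarrow> 'v) \<Rightarrow> 'k) set \<Rightarrow> (('i \<Rightarrow> 'v) \<Rightarrow> 'k) set" where
  "tensor_action J V \<rho> g =
     quot_map (free_space (\<Pi>\<^sub>E j\<in>J. carrier (V j))) (tensor_null J V)
       (free_map (\<lambda>v. \<lambda>j\<in>J. \<rho> j g (v j)))"

text \<open>
  \<open>group_action\<close> makes \<open>\<rho>\<close> a homomorphism into the bijections of the carrier, which are
  extensional functions.
\<close>

definition linear_rep ::
  "('g, 'b) monoid_scheme \<Rightarrow> ('k::field, 'v) module \<Rightarrow> ('g \<Rightarrow> 'v \<Rightarrow> 'v) \<Rightarrow> bool" where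
  "linear_rep G V \<rho> \<longleftrightarrow>
     vectorspace class_ring V \<and> group_action G (carrier V) \<rho> \<and>
     (\<forall>g\<in>carrier G. linear_map class_ring V V (\<rho> g))"

definition monomial_rep ::
  "('g, 'b) monoid_scheme \<Rightarrow> ('k::field, 'v) module \<Rightarrow> ('g \<Rightarrow> 'v \<Rightarrow> 'v) \<Rightarrow> 'v set \<Rightarrow> bool" where
  "monomial_rep G V \<rho> B \<longleftrightarrow>
     linear_rep G V \<rho> \<and> vectorspace.basis class_ring V B \<and>
     (\<forall>g\<in>carrier G. \<forall>b\<in>B. \<exists>c. c \<noteq> 0 \<and> (\<exists>b'\<in>B. \<rho> g b = c \<odot>\<^bsub>V\<^esub> b'))"

definition one_dim_char :: "('g, 'b) monoid_scheme \<Rightarrow> ('g \<Rightarrow> 'k::field) \<Rightarrow> bool" where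
  "one_dim_char G \<chi> \<longleftrightarrow> \<chi> \<in> hom G (units_of class_ring)"

definition group_algebra :: "('g, 'b) monoid_scheme \<Rightarrow> ('k::field, 'g \<Rightarrow> 'k) module" where
  "group_algebra G = (free_space (carrier G))
    \<lparr>mult := (\<lambda>a b x. \<Sum>g\<in>{g. a g \<noteq> 0}. \<Sum>h\<in>{h. b h \<noteq> 0}. if g \<otimes>\<^bsub>G\<^esub> h = x then a g * b h else 0),
     one := single \<one>\<^bsub>G\<^esub>\<rparr>"

text \<open>The space \<open>K\<^sub>\<chi>\<close> and its left module structure over the group algebra.\<close>

definition line_space :: "('k::field, 'k) module" where
  "line_space = \<lparr>carrier = UNIV, mult = undefined, one = undefined,
     zero = 0, add = (+), smult = (*)\<rparr>"

definition char_action :: "('g \<Rightarrow> 'k::field) \<Rightarrow> ('g \<Rightarrow> 'k) \<Rightarrow> 'k \<Rightarrow> 'k" where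
  "char_action \<chi> a c = (\<Sum>w\<in>{w. a w \<noteq> 0}. a w * (\<chi> w * c))"

text \<open>
  \<open>ind_space G W \<chi>\<close> is \<open>KG \<otimes>\<^bsub>KW\<^esub> K\<^sub>\<chi>\<close>; elements of \<open>KW\<close> are elements of \<open>KG\<close> supported on \<open>W\<close>.
\<close>

definition ind_null ::
  "('g, 'b) monoid_scheme \<Rightarrow> 'g set \<Rightarrow> ('g \<Rightarrow> 'k::field) \<Rightarrow> (('g \<Rightarrow> 'k) \<times> 'k \<Rightarrow> 'k) set" where
  "ind_null G W \<chi> =
     bal_null (carrier (group_algebra (G\<lparr>carrier := W\<rparr>)))
       (group_algebra G) (\<otimes>\<^bsub>group_algebra G\<^esub>) line_space (char_action \<chi>)"

definition ind_space ::
  "('g, 'b) monoid_scheme \<Rightarrow> 'g set \<Rightarrow> ('g \<Rightarrow> 'k::field)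
    \<Rightarrow> ('k, (('g \<Rightarrow> 'k) \<times> 'k \<Rightarrow> 'k) set) module" where
  "ind_space G W \<chi> =
     bal_tensor (carrier (group_algebra (G\<lparr>carrier := W\<rparr>)))
       (group_algebra G) (\<otimes>\<^bsub>group_algebra G\<^esub>) line_space (char_action \<chi>)"

text \<open>\<open>g (a \<otimes> c) = (g a) \<otimes> c\<close>\<close>

definition ind_action ::
  "('g, 'b) monoid_scheme \<Rightarrow> 'g set \<Rightarrow> ('g \<Rightarrow> 'k::field) \<Rightarrow> 'g
    \<Rightarrow> (('g \<Rightarrow> 'k) \<times> 'k \<Rightarrow> 'k) set \<Rightarrow> (('g \<Rightarrow> 'k) \<times> 'k \<Rightarrow> 'k) set" where
  "ind_action G W \<chi> g =
     quot_map (free_space (carrier (group_algebra G) \<times> carrier line_space)) (ind_null G W \<chi>)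
       (free_map (\<lambda>(a, c). (single g \<otimes>\<^bsub>group_algebra G\<^esub> a, c)))"

text \<open>\<open>e\<^sub>i = i \<otimes> 1\<close>\<close>

definition ind_vec ::
  "('g, 'b) monoid_scheme \<Rightarrow> 'g set \<Rightarrow> ('g \<Rightarrow> 'k::field) \<Rightarrow> 'g \<Rightarrow> (('g \<Rightarrow> 'k) \<times> 'k \<Rightarrow> 'k) set" where
  "ind_vec G W \<chi> i =
     a_r_coset (free_space (carrier (group_algebra G) \<times> carrier line_space))
       (ind_null G W \<chi>) (single (single i, 1))"

definition left_transversal :: "('g, 'b) monoid_scheme \<Rightarrow> 'g set \<Rightarrow> 'g set \<Rightarrow> bool" where
  "left_transversal G W I \<longleftrightarrow> I \<subseteq> carrier G \<and> (\<forall>C\<in>lcosets\<^bsub>G\<^esub> W. \<exists>!i. i \<in> I \<and> i \<in> C)"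

definition trans_action ::
  "('g, 'b) monoid_scheme \<Rightarrow> 'g set \<Rightarrow> 'g set \<Rightarrow> 'g \<Rightarrow> 'g \<Rightarrow> 'g" where
  "trans_action G W I z i = (THE j. j \<in> I \<and> inv\<^bsub>G\<^esub> j \<otimes>\<^bsub>G\<^esub> z \<otimes>\<^bsub>G\<^esub> i \<in> W)"

definition trans_coeff ::
  "('g, 'b) monoid_scheme \<Rightarrow> 'g set \<Rightarrow> ('g \<Rightarrow> 'k::field) \<Rightarrow> 'g set \<Rightarrow> 'g \<Rightarrow> 'g \<Rightarrow> 'k" where
  "trans_coeff G W \<chi> I i z =
     \<chi> (inv\<^bsub>G\<^esub> (trans_action G W I z i) \<otimes>\<^bsub>G\<^esub> z \<otimes>\<^bsub>G\<^esub> i)"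

lemma trans_action_ex1:
  assumes "group G" "subgroup W G" "left_transversal G W I" "z \<in> carrier G" "i \<in> I"
  shows "\<exists>!j. j \<in> I \<and> inv\<^bsub>G\<^esub> j \<otimes>\<^bsub>G\<^esub> z \<otimes>\<^bsub>G\<^esub> i \<in> W"
proof -
  interpret group G by fact
  have I: "I \<subseteq> carrier G" and i: "i \<in> carrier G"
    using assms(3,5) by (auto simp: left_transversal_def)
  let ?g = "z \<otimes>\<^bsub>G\<^esub> i"
  have g: "?g \<in> carrier G" using assms(4) i by simp
  have W: "W \<subseteq> carrier G" using assms(2) by (rule subgroup.subset)
  have "?g <#\<^bsub>G\<^esub> W \<in> lcosets\<^bsub>G\<^esub> W" using g by (auto simp: LCOSETS_def)
  then have ex1: "\<exists>!j. j \<in> I \<and> j \<in> ?g <#\<^bsub>G\<^esub> W"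
    using assms(3) by (auto simp: left_transversal_def)
  have eq: "j \<in> ?g <#\<^bsub>G\<^esub> W \<longleftrightarrow> inv\<^bsub>G\<^esub> j \<otimes>\<^bsub>G\<^esub> z \<otimes>\<^bsub>G\<^esub> i \<in> W" if "j \<in> I" for j
  proof -
    have j: "j \<in> carrier G" using that I by auto
    have a: "inv\<^bsub>G\<^esub> j \<otimes>\<^bsub>G\<^esub> z \<otimes>\<^bsub>G\<^esub> i = inv\<^bsub>G\<^esub> j \<otimes>\<^bsub>G\<^esub> ?g"
      using j assms(4) i by (simp add: m_assoc)
    show ?thesis unfolding a
    proof
      assume "j \<in> ?g <#\<^bsub>G\<^esub> W"
      then obtain w where w: "w \<in> W" "j = ?g \<otimes>\<^bsub>G\<^esub> w" by (auto simp: l_coset_def)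
      then have "inv\<^bsub>G\<^esub> j \<otimes>\<^bsub>G\<^esub> ?g = inv\<^bsub>G\<^esub> w"
        using g W by (auto simp: inv_mult_group m_assoc subset_iff simp del: m_closed)
      then show "inv\<^bsub>G\<^esub> j \<otimes>\<^bsub>G\<^esub> ?g \<in> W"
        using w assms(2) by (simp add: subgroup.m_inv_closed)
    next
      assume *: "inv\<^bsub>G\<^esub> j \<otimes>\<^bsub>G\<^esub> ?g \<in> W"
      have "inv\<^bsub>G\<^esub> (inv\<^bsub>G\<^esub> j \<otimes>\<^bsub>G\<^esub> ?g) \<in> W" using * assms(2) by (rule subgroup.m_inv_closed[rotated])
      moreover have "j = ?g \<otimes>\<^bsub>G\<^esub> inv\<^bsub>G\<^esub> (inv\<^bsub>G\<^esub> j \<otimes>\<^bsub>G\<^esub> ?g)"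
        using j g by (simp add: inv_mult_group m_assoc[symmetric] r_inv del: m_closed)
      ultimately show "j \<in> ?g <#\<^bsub>G\<^esub> W" unfolding l_coset_def by blast
    qed
  qed
  then show ?thesis using ex1 by (auto cong: conj_cong)
qed

end

theory Submission
  imports Defs
begin

text \<open>
  All the spaces involved are quotients of a free space by the span of a set of relations. To show
  that the classes of certain generators form a basis of such a quotient it suffices to see that
  they generate it modulo the relations and to exhibit linear functionals that vanish on the
  relations and are dual to the generators. For an induced representation the functionals are
  \<open>a \<otimes> y \<mapsto> (\<Sum>w\<in>W. a (i w) \<chi>(w) y)\<close>; for a tensor product they are the products of the
  coordinate functionals of the factors. The action on \<open>e\<^sub>i\<close> in one factor is
  \<open>\<zeta> i \<otimes> 1 = j w \<otimes> 1 = \<chi>(w) (j \<otimes> 1)\<close> with \<open>j = s(\<zeta>)(i)\<close> and \<open>w = j\<^sup>-\<^sup>1 \<zeta> i\<close>, and multilinearity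
  collects the scalars in the tensor product.
\<close>

section \<open>Bases with coordinates\<close>

text \<open>Bare linear independence does not pass from the factors to the tensor product, and in a
  quotient by a span of relations it is hard to see from inside. The property handed from one stage
  to the next is therefore the existence of coordinates: a functional on a free space descends as
  soon as it kills the relations, and coordinates can be recombined across factors. The second
  obstacle is size. The free spaces have every element of a module, or every tuple of such elements,
  as a generator. Generation is therefore phrased through an arbitrary submodule \<open>N\<close>
  containing the relations and the chosen generators, and relations become a means of exchanging one
  member of \<open>N\<close> for another.\<close>

abbreviation kspan :: "('k::field, 'v) module \<Rightarrow> 'v set \<Rightarrow> 'v set" where
  "kspan V S \<equiv> LinearCombinations.module.span class_ring V S"

lemma vectorspace_class_ringI:
  fixes V :: "('k::field, 'v) module"
  assumes "\<zero>\<^bsub>V\<^esub> \<in> carrier V"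
    and "\<And>v w. v \<in> carrier V \<Longrightarrow> w \<in> carrier V \<Longrightarrow> v \<oplus>\<^bsub>V\<^esub> w \<in> carrier V"
    and "\<And>c v. v \<in> carrier V \<Longrightarrow> c \<odot>\<^bsub>V\<^esub> v \<in> carrier V"
    and "\<And>v w. v \<in> carrier V \<Longrightarrow> w \<in> carrier V \<Longrightarrow> v \<oplus>\<^bsub>V\<^esub> w = w \<oplus>\<^bsub>V\<^esub> v"
    and "\<And>u v w. u \<in> carrier V \<Longrightarrow> v \<in> carrier V \<Longrightarrow> w \<in> carrier V \<Longrightarrow>
           (u \<oplus>\<^bsub>V\<^esub> v) \<oplus>\<^bsub>V\<^esub> w = u \<oplus>\<^bsub>V\<^esub> (v \<oplus>\<^bsub>V\<^esub> w)"
    and "\<And>v. v \<in> carrier V \<Longrightarrow> v \<oplus>\<^bsub>V\<^esub> \<zero>\<^bsub>V\<^esub> = v"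
    and "\<And>v. v \<in> carrier V \<Longrightarrow> v \<oplus>\<^bsub>V\<^esub> (-1) \<odot>\<^bsub>V\<^esub> v = \<zero>\<^bsub>V\<^esub>"
    and "\<And>a b v. v \<in> carrier V \<Longrightarrow> (a * b) \<odot>\<^bsub>V\<^esub> v = a \<odot>\<^bsub>V\<^esub> (b \<odot>\<^bsub>V\<^esub> v)"
    and "\<And>v. v \<in> carrier V \<Longrightarrow> 1 \<odot>\<^bsub>V\<^esub> v = v"
    and "\<And>a b v. v \<in> carrier V \<Longrightarrow> (a + b) \<odot>\<^bsub>V\<^esub> v = a \<odot>\<^bsub>V\<^esub> v \<oplus>\<^bsub>V\<^esub> b \<odot>\<^bsub>V\<^esub> v"
    and "\<And>a v w. v \<in> carrier V \<Longrightarrow> w \<in> carrier V \<Longrightarrow>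
           a \<odot>\<^bsub>V\<^esub> (v \<oplus>\<^bsub>V\<^esub> w) = a \<odot>\<^bsub>V\<^esub> v \<oplus>\<^bsub>V\<^esub> a \<odot>\<^bsub>V\<^esub> w"
  shows "vectorspace class_ring V"
proof (intro vectorspace.intro class_field module_criteria)
  show "cring (class_ring :: 'k ring)" by unfold_locales
  show "\<forall>v\<in>carrier V. \<exists>w\<in>carrier V. v \<oplus>\<^bsub>V\<^esub> w = \<zero>\<^bsub>V\<^esub>"
    using assms(3,7) by blast
qed (use assms in auto)

lemma functional_lincomb:
  fixes V :: "('k::field, 'v) module"
  assumes "vectorspace class_ring V"
    and add: "\<And>x y. x \<in> carrier V \<Longrightarrow> y \<in> carrier V \<Longrightarrow> \<kappa> (x \<oplus>\<^bsub>V\<^esub> y) = \<kappa> x + \<kappa> y"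
    and smult: "\<And>c x. x \<in> carrier V \<Longrightarrow> \<kappa> (c \<odot>\<^bsub>V\<^esub> x) = c * (\<kappa> x :: 'k)"
    and "finite A" "A \<subseteq> carrier V"
  shows "\<kappa> (module.lincomb V a A) = (\<Sum>v\<in>A. a v * \<kappa> v)"
proof -
  interpret vectorspace class_ring V by fact
  have k0: "\<kappa> \<zero>\<^bsub>V\<^esub> = 0" using smult[of "\<zero>\<^bsub>V\<^esub>" 0] lmult_0[of "\<zero>\<^bsub>V\<^esub>"] by simp
  show ?thesis using assms(4,5)
  proof (induction A rule: finite_induct)
    case empty
    then show ?case by (simp add: lincomb_def k0)
  next
    case (insert x F)
    then have "lincomb a (insert x F) = a x \<odot>\<^bsub>V\<^esub> x \<oplus>\<^bsub>V\<^esub> lincomb a F"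
      using lincomb_insert[of F a x] by auto
    moreover have "lincomb a F \<in> carrier V" "a x \<odot>\<^bsub>V\<^esub> x \<in> carrier V" using insert.prems by auto
    ultimately show ?case using insert by (simp add: add smult)
  qed
qed

text \<open>Dual functionals stand in for linear independence. They are constrained only on the
  carrier and for indices in \<open>I\<close>.\<close>

definition coord_basis ::
  "('k::field, 'v) module \<Rightarrow> 'i set \<Rightarrow> ('i \<Rightarrow> 'v) \<Rightarrow> ('v \<Rightarrow> 'i \<Rightarrow> 'k) \<Rightarrow> bool" where
  "coord_basis V I e \<kappa> \<longleftrightarrow>
     vectorspace class_ring V \<and> finite I \<and> e ` I \<subseteq> carrier V \<and> kspan V (e ` I) = carrier V \<and>
     (\<forall>i\<in>I. (\<forall>x\<in>carrier V. \<forall>y\<in>carrier V. \<kappa> (x \<oplus>\<^bsub>V\<^esub> y) i = \<kappa> x i + \<kappa> y i) \<and>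
             (\<forall>c. \<forall>x\<in>carrier V. \<kappa> (c \<odot>\<^bsub>V\<^esub> x) i = c * \<kappa> x i) \<and>
             (\<forall>j\<in>I. \<kappa> (e j) i = (if i = j then 1 else 0)))"

lemma coord_basis_inj_on:
  assumes "coord_basis V I e \<kappa>"
  shows "inj_on e I"
proof (rule inj_onI)
  fix i j assume "i \<in> I" "j \<in> I" "e i = e j"
  with assms show "i = j" unfolding coord_basis_def by (metis one_neq_zero)
qed

text \<open>The functional at \<open>i\<close>, applied to a vanishing combination, leaves just the
  coefficient of \<open>e i\<close>. Passing from a sum over vectors to a sum over indices uses
  injectivity of \<open>e\<close>.\<close>

lemma coord_basis_basis:
  assumes cb: "coord_basis V I e \<kappa>"
  shows "vectorspace.basis class_ring V (e ` I)"
proof -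
  interpret vectorspace class_ring V using cb by (simp add: coord_basis_def)
  have fin: "finite (e ` I)" and sub: "e ` I \<subseteq> carrier V" and gen: "kspan V (e ` I) = carrier V"
    using cb by (auto simp: coord_basis_def)
  have "lin_indpt (e ` I)"
  proof (rule finite_lin_indpt2[OF fin sub])
    fix a assume a0: "lincomb a (e ` I) = \<zero>\<^bsub>V\<^esub>"
    have "a (e i) = 0" if i: "i \<in> I" for i
    proof -
      have add: "\<And>x y. x \<in> carrier V \<Longrightarrow> y \<in> carrier V \<Longrightarrow> \<kappa> (x \<oplus>\<^bsub>V\<^esub> y) i = \<kappa> x i + \<kappa> y i"
        and smult: "\<And>c x. x \<in> carrier V \<Longrightarrow> \<kappa> (c \<odot>\<^bsub>V\<^esub> x) i = c * \<kappa> x i"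
        and dual: "\<And>j. j \<in> I \<Longrightarrow> \<kappa> (e j) i = (if i = j then 1 else 0)"
        using cb i unfolding coord_basis_def by auto
      have "\<kappa> (lincomb a (e ` I)) i = (\<Sum>v\<in>e ` I. a v * \<kappa> v i)"
        by (rule functional_lincomb[where \<kappa> = "\<lambda>v. \<kappa> v i", OF vectorspace_axioms add smult fin sub])
      also have "\<dots> = (\<Sum>j\<in>I. a (e j) * \<kappa> (e j) i)"
        by (simp add: sum.reindex[OF coord_basis_inj_on[OF cb]])
      also have "\<dots> = (\<Sum>j\<in>I. if i = j then a (e j) else 0)"
        by (rule sum.cong) (auto simp: dual)
      also have "\<dots> = a (e i)" using cb i by (simp add: coord_basis_def)
      finally have "a (e i) = \<kappa> \<zero>\<^bsub>V\<^esub> i" using a0 by simp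
      also have "\<dots> = 0" using smult[of "\<zero>\<^bsub>V\<^esub>" 0] lmult_0[of "\<zero>\<^bsub>V\<^esub>"] by simp
      finally show ?thesis .
    qed
    then show "\<forall>v\<in>e ` I. a v = \<zero>\<^bsub>class_ring\<^esub>" by auto
  qed
  then show ?thesis using gen sub by (simp add: basis_def)
qed

text \<open>The members of the carrier satisfying \<open>P\<close> form a submodule that contains
  the generators. In this form a single tensor factor gets expanded later.\<close>

lemma coord_basis_induct [consumes 2, case_names zero basis add smult]:
  assumes cb: "coord_basis V I e \<kappa>" and x: "x \<in> carrier V"
    and "P \<zero>\<^bsub>V\<^esub>" "\<And>i. i \<in> I \<Longrightarrow> P (e i)"
    and "\<And>x y. x \<in> carrier V \<Longrightarrow> y \<in> carrier V \<Longrightarrow> P x \<Longrightarrow> P y \<Longrightarrow> P (x \<oplus>\<^bsub>V\<^esub> y)"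
    and "\<And>c x. x \<in> carrier V \<Longrightarrow> P x \<Longrightarrow> P (c \<odot>\<^bsub>V\<^esub> x)"
  shows "P x"
proof -
  interpret vectorspace class_ring V using cb by (simp add: coord_basis_def)
  have "submodule class_ring {x \<in> carrier V. P x} V"
    by (rule submodule.intro) (use assms module_axioms in auto)
  then have "kspan V (e ` I) \<subseteq> {x \<in> carrier V. P x}"
    by (rule span_is_subset[rotated]) (use assms in \<open>auto simp: coord_basis_def\<close>)
  then show ?thesis using cb x by (auto simp: coord_basis_def)
qed

section \<open>Quotient spaces\<close>

locale quotient_space = vectorspace class_ring V
  for V :: "('k::field, 'v) module" (structure) +
  fixes U
  assumes U: "submodule class_ring U V"
begin

lemma U_sub: "U \<subseteq> carrier V"
  using U by (rule submodule.subset)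

lemma U_abelian_subgroup: "abelian_subgroup U V"
proof (rule abelian_subgroupI3[OF additive_subgroup.intro])
  show "subgroup U (add_monoid V)"
  proof (rule add.subgroupI)
    fix a assume a: "a \<in> U"
    then have "\<ominus> a = (-1) \<odot> a" using U_sub smult_minus_1[of a]
      by (auto simp: class_ring_simps)
    then show "\<ominus> a \<in> U" using submodule.smult_closed[OF U] a by simp
  qed (use U_sub submodule.m_closed[OF U] submodule.zero_closed[OF U] in auto)
qed (rule abelian_group_axioms)

sublocale U: abelian_subgroup U V
  by (rule U_abelian_subgroup)

lemma coset_eq_iff:
  assumes "v \<in> carrier V" "w \<in> carrier V"
  shows "U +> v = U +> w \<longleftrightarrow> v \<ominus> w \<in> U"
proof -
  have "U +> v = U +> w \<longleftrightarrow> v \<in> U +> w"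
    using assms U.a_rcos_self U.a_repr_independence' by metis
  then show ?thesis using assms by (simp add: U.a_rcos_module a_minus_def)
qed

lemma coset_cases:
  assumes "C \<in> carrier (quot_space V U)"
  obtains v where "v \<in> carrier V" "C = U +> v"
  using assms by (auto simp: quot_space_def A_RCOSETS_def')

lemma coset_closed: "v \<in> carrier V \<Longrightarrow> U +> v \<in> carrier (quot_space V U)"
  by (auto simp: quot_space_def A_RCOSETS_def')

lemma coset_add:
  "v \<in> carrier V \<Longrightarrow> w \<in> carrier V \<Longrightarrow> (U +> v) \<oplus>\<^bsub>quot_space V U\<^esub> (U +> w) = U +> (v \<oplus> w)"
  by (simp add: quot_space_def U.a_rcos_sum)

lemma coset_zero: "\<zero>\<^bsub>quot_space V U\<^esub> = U +> \<zero>"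
  using U_sub by (simp add: quot_space_def)

text \<open>Representatives of one coset differ by some \<open>u\<close> in \<open>U\<close>, and
  \<open>T u\<close> stays in \<open>U\<close>, so the union runs over equal cosets. Scaling and
  induced maps on the quotient are both defined by such unions, and one argument serves
  both.\<close>

lemma UN_coset_eq:
  assumes v: "v \<in> carrier V" and T: "T \<in> carrier V \<rightarrow> carrier V"
    and "\<And>x y. x \<in> carrier V \<Longrightarrow> y \<in> carrier V \<Longrightarrow> T (x \<oplus> y) = T x \<oplus> T y"
    and "\<And>x. x \<in> U \<Longrightarrow> T x \<in> U"
  shows "(\<Union>x\<in>U +> v. U +> T x) = U +> T v"
proof -
  have "U +> T x = U +> T v" if "x \<in> U +> v" for x
  proof -
    obtain u where u: "u \<in> U" "x = u \<oplus> v" using \<open>x \<in> U +> v\<close> by (auto simp: a_r_coset_def')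
    have uV: "u \<in> carrier V" using u U_sub by auto
    then have "T x = T u \<oplus> T v" using u v assms(3) by auto
    moreover have "T u \<in> carrier V" "T v \<in> carrier V" using uV v T by auto
    ultimately have "T x \<ominus> T v = T u" "T x \<in> carrier V"
      by (auto simp: a_minus_def M.add.m_assoc r_neg)
    then show ?thesis using assms(4)[OF u(1)] coset_eq_iff \<open>T v \<in> carrier V\<close> by auto
  qed
  moreover have "v \<in> U +> v" using v by (rule U.a_rcos_self)
  ultimately show ?thesis by blast
qed

lemma coset_smult: "v \<in> carrier V \<Longrightarrow> c \<odot>\<^bsub>quot_space V U\<^esub> (U +> v) = U +> (c \<odot> v)"
  using UN_coset_eq[of v "\<lambda>x. c \<odot> x"] submodule.smult_closed[OF U]
  by (simp add: quot_space_def smult_r_distr)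

lemma quot_map_coset:
  assumes "v \<in> carrier V" "T \<in> carrier V \<rightarrow> carrier V"
    and "\<And>x y. x \<in> carrier V \<Longrightarrow> y \<in> carrier V \<Longrightarrow> T (x \<oplus> y) = T x \<oplus> T y"
    and "\<And>x. x \<in> U \<Longrightarrow> T x \<in> U"
  shows "quot_map V U T (U +> v) = U +> T v"
  using UN_coset_eq[OF assms] coset_closed[OF assms(1)] by (simp add: quot_map_def)

lemma quot_vectorspace: "vectorspace class_ring (quot_space V U)"
proof (rule vectorspace_class_ringI)
  let ?Q = "quot_space V U"
  show "\<zero>\<^bsub>?Q\<^esub> \<in> carrier ?Q" by (simp add: coset_zero coset_closed)
  show "v \<oplus>\<^bsub>?Q\<^esub> (-1) \<odot>\<^bsub>?Q\<^esub> v = \<zero>\<^bsub>?Q\<^esub>" if v: "v \<in> carrier ?Q" for v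
  proof -
    obtain x where x: "x \<in> carrier V" "v = U +> x" using v by (rule coset_cases)
    have "(-1) \<odot> x = \<ominus> x" using smult_minus_1[of x] x by (auto simp: class_ring_simps)
    then show ?thesis using x by (simp add: coset_add coset_smult coset_zero r_neg)
  qed
  show "(a * b) \<odot>\<^bsub>?Q\<^esub> v = a \<odot>\<^bsub>?Q\<^esub> (b \<odot>\<^bsub>?Q\<^esub> v)" if "v \<in> carrier ?Q" for a b v
    using that smult_assoc1[of a b] by (auto elim!: coset_cases simp: coset_smult)
  show "(a + b) \<odot>\<^bsub>?Q\<^esub> v = a \<odot>\<^bsub>?Q\<^esub> v \<oplus>\<^bsub>?Q\<^esub> b \<odot>\<^bsub>?Q\<^esub> v" if "v \<in> carrier ?Q" for a b v
    using that smult_l_distr[of a b] by (auto elim!: coset_cases simp: coset_smult coset_add)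
  show "1 \<odot>\<^bsub>?Q\<^esub> v = v" if "v \<in> carrier ?Q" for v
    using that smult_one by (auto elim!: coset_cases simp: coset_smult)
qed (auto elim!: coset_cases simp: coset_add coset_smult coset_zero coset_closed
      M.add.m_ac smult_r_distr)

text \<open>Turns a spanning question about cosets into one about submodules of \<open>V\<close>
  above \<open>U\<close>, where relations can be used as memberships.\<close>

lemma quot_kspan_eqI:
  assumes S: "S \<subseteq> carrier V"
    and N: "\<And>N x. submodule class_ring N V \<Longrightarrow> U \<subseteq> N \<Longrightarrow> S \<subseteq> N \<Longrightarrow> x \<in> carrier V \<Longrightarrow> x \<in> N"
  shows "kspan (quot_space V U) ((\<lambda>v. U +> v) ` S) = carrier (quot_space V U)"
proof -
  interpret Q: vectorspace class_ring "quot_space V U" by (rule quot_vectorspace)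
  let ?S = "(\<lambda>v. U +> v) ` S"
  have S': "?S \<subseteq> carrier (quot_space V U)" using S coset_closed by auto
  \<comment> \<open>The test submodule is the preimage of the span; it contains \<open>U\<close>
    because elements of \<open>U\<close> go to the zero coset.\<close>
  let ?N = "{v \<in> carrier V. U +> v \<in> Q.span ?S}"
  have sub: "submodule class_ring (Q.span ?S) (quot_space V U)"
    by (rule Q.span_is_submodule[OF S'])
  have "submodule class_ring ?N V"
    by (rule submodule.intro)
      (use sub module_axioms in \<open>auto simp: submodule_def simp flip: coset_add coset_smult coset_zero\<close>)
  moreover have "U \<subseteq> ?N"
  proof
    fix u assume u: "u \<in> U"
    then have "U +> u = U" "u \<in> carrier V" using U_sub
      by (auto simp: U.a_rcos_const)
    then show "u \<in> ?N" using submodule.zero_closed[OF sub] by (simp add: quot_space_def)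
  qed
  moreover have "S \<subseteq> ?N" using S Q.in_own_span[OF S'] by auto
  ultimately have "carrier V \<subseteq> ?N" using N by blast
  then have "carrier (quot_space V U) \<subseteq> Q.span ?S" by (auto elim!: coset_cases)
  then show ?thesis using Q.span_is_subset2[OF S'] by auto
qed

end

section \<open>Free spaces and their quotients\<close>

lemma free_space_simps [simp]:
  "\<zero>\<^bsub>free_space X\<^esub> = (\<lambda>x. 0)"
  "f \<oplus>\<^bsub>free_space X\<^esub> g = (\<lambda>x. f x + g x)"
  "c \<odot>\<^bsub>free_space X\<^esub> f = (\<lambda>x. c * f x)"
  by (simp_all add: free_space_def)

lemma free_space_carrier:
  "f \<in> carrier (free_space X) \<longleftrightarrow> finite {x. f x \<noteq> 0} \<and> {x. f x \<noteq> 0} \<subseteq> X"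
  by (simp add: free_space_def)

lemma finite_support_add:
  "finite {x. f x \<noteq> (0::'k::field)} \<Longrightarrow> finite {x. g x \<noteq> 0} \<Longrightarrow> finite {x. f x + g x \<noteq> 0}"
  by (rule finite_subset[of _ "{x. f x \<noteq> 0} \<union> {x. g x \<noteq> 0}"]) auto

lemma finite_support_diff:
  "finite {x. f x \<noteq> (0::'k::field)} \<Longrightarrow> finite {x. g x \<noteq> 0} \<Longrightarrow> finite {x. (f - g) x \<noteq> 0}"
  by (rule finite_subset[of _ "{x. f x \<noteq> 0} \<union> {x. g x \<noteq> 0}"]) auto

lemma finite_support_smult:
  "finite {x. f x \<noteq> (0::'k::field)} \<Longrightarrow> finite {x. c * f x \<noteq> 0}"
  by (rule finite_subset[of _ "{x. f x \<noteq> 0}"]) auto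

lemma finite_support_single: "finite {y. single x y \<noteq> (0::'k::field)}"
  by (simp add: single_def)

lemmas finite_support =
  finite_support_add finite_support_diff finite_support_smult finite_support_single

lemma single_carrier [simp]: "single x \<in> carrier (free_space X) \<longleftrightarrow> x \<in> X"
  by (auto simp: free_space_carrier single_def)

lemma free_space_finite_support: "f \<in> carrier (free_space X) \<Longrightarrow> finite {x. f x \<noteq> 0}"
  by (simp add: free_space_carrier)

lemma free_space_add_closed:
  assumes "f \<in> carrier (free_space X)" "g \<in> carrier (free_space X)"
  shows "(\<lambda>x. f x + g x) \<in> carrier (free_space X)"
proof -
  have "{x. f x + g x \<noteq> 0} \<subseteq> {x. f x \<noteq> 0} \<union> {x. g x \<noteq> 0}" by auto
  then show ?thesis using assms finite_support_add[of f g] by (simp add: free_space_carrier) blast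
qed

lemma free_space_smult_closed:
  "f \<in> carrier (free_space X) \<Longrightarrow> (\<lambda>x. c * f x) \<in> carrier (free_space X)"
  using finite_support_smult[of f c] by (auto simp: free_space_carrier)

lemma free_space_diff_closed:
  "f \<in> carrier (free_space X) \<Longrightarrow> g \<in> carrier (free_space X) \<Longrightarrow> f - g \<in> carrier (free_space X)"
  using free_space_add_closed[of f X "\<lambda>x. (-1) * g x"] free_space_smult_closed[of g X "-1"]
  by (simp add: fun_diff_def)

lemma free_space_zero_closed: "(\<lambda>x. 0) \<in> carrier (free_space X)"
  by (simp add: free_space_carrier)

lemma free_space_vectorspace: "vectorspace class_ring (free_space X)"
  by (rule vectorspace_class_ringI)
    (auto simp: algebra_simps free_space_add_closed free_space_smult_closed free_space_zero_closed)

context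
  fixes X :: "'x set" and N :: "('x \<Rightarrow> 'k::field) set"
  assumes N: "submodule class_ring N (free_space X)"
begin

lemma submodule_free_add: "f \<in> N \<Longrightarrow> g \<in> N \<Longrightarrow> (\<lambda>x. f x + g x) \<in> N"
  using submodule.m_closed[OF N, of f g] by simp

lemma submodule_free_smult: "f \<in> N \<Longrightarrow> (\<lambda>x. c * f x) \<in> N"
  using submodule.smult_closed[OF N, of c f] by simp

text \<open>With \<open>f - g\<close> a relation, this trades \<open>f\<close> for \<open>g\<close>
  modulo \<open>N\<close>. Both generation arguments below run through this exchange.\<close>

lemma submodule_free_diffD: "f - g \<in> N \<Longrightarrow> g \<in> N \<Longrightarrow> f \<in> N"
  using submodule_free_add[of "f - g" g] by simp

text \<open>Finite support makes every element a finite combination of generators. The induction is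
  over a finite set containing the support, one point being cleared at a time.\<close>

lemma submodule_free_single:
  assumes "single ` X \<subseteq> N" and "f \<in> carrier (free_space X)"
  shows "f \<in> N"
proof -
  have "f \<in> N" if "finite S" "S \<subseteq> X" "{x. f x \<noteq> 0} \<subseteq> S" for S f
    using that
  proof (induction S arbitrary: f rule: finite_induct)
    case empty
    then have "f = (\<lambda>x. 0)" by auto
    then show ?case using submodule.zero_closed[OF N] by simp
  next
    case (insert a S)
    have "f(a := 0) \<in> N" using insert by (intro insert.IH) auto
    moreover have "(\<lambda>x. f a * single a x) \<in> N"
      using submodule_free_smult[of "single a" "f a"] assms(1) insert.prems(1) by auto
    ultimately have "(\<lambda>x. (f(a := 0)) x + f a * single a x) \<in> N"
      by (rule submodule_free_add)
    moreover have "(\<lambda>x. (f(a := 0)) x + f a * single a x) = f"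
      by (auto simp: single_def)
    ultimately show ?case by simp
  qed
  then show ?thesis using assms(2) by (auto simp: free_space_carrier)
qed

end

section \<open>Linear functionals and linear maps prescribed on generators\<close>

definition lin_ext :: "('x \<Rightarrow> 'k::field) \<Rightarrow> ('x \<Rightarrow> 'k) \<Rightarrow> 'k" where
  "lin_ext c f = (\<Sum>x\<in>{x. f x \<noteq> 0}. f x * c x)"

lemma lin_ext_eq_sum:
  "finite S \<Longrightarrow> {x. f x \<noteq> 0} \<subseteq> S \<Longrightarrow> lin_ext c f = (\<Sum>x\<in>S. f x * c x)"
  unfolding lin_ext_def by (rule sum.mono_neutral_left) auto

lemma lin_ext_zero [simp]: "lin_ext c (\<lambda>x. 0) = 0"
  by (simp add: lin_ext_def)

lemma lin_ext_single [simp]: "lin_ext c (single x) = c x"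
  by (simp add: lin_ext_def single_def)

text \<open>Supports may shrink by cancellation, so all three sums are taken over the union of the
  two supports. Finiteness matters: a sum over an infinite support has the default value 0.\<close>

lemma lin_ext_add:
  assumes "finite {x. f x \<noteq> 0}" "finite {x. g x \<noteq> 0}"
  shows "lin_ext c (\<lambda>x. f x + g x) = lin_ext c f + lin_ext c g"
proof -
  let ?S = "{x. f x \<noteq> 0} \<union> {x. g x \<noteq> 0}"
  have fin: "finite ?S" using assms by simp
  have "lin_ext c (\<lambda>x. f x + g x) = (\<Sum>x\<in>?S. (f x + g x) * c x)"
    by (rule lin_ext_eq_sum[OF fin]) auto
  moreover have "lin_ext c f = (\<Sum>x\<in>?S. f x * c x)" "lin_ext c g = (\<Sum>x\<in>?S. g x * c x)"
    by (rule lin_ext_eq_sum[OF fin]; auto)+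
  ultimately show ?thesis by (simp only: distrib_right sum.distrib)
qed

lemma lin_ext_smult:
  assumes "finite {x. f x \<noteq> 0}"
  shows "lin_ext c (\<lambda>x. a * f x) = a * lin_ext c f"
  using lin_ext_eq_sum[of "{x. f x \<noteq> 0}" _ c] assms
  by (simp add: subset_iff sum_distrib_left algebra_simps)

lemma lin_ext_diff:
  assumes "finite {x. f x \<noteq> 0}" "finite {x. g x \<noteq> 0}"
  shows "lin_ext c (f - g) = lin_ext c f - lin_ext c g"
  using lin_ext_add[of f "\<lambda>x. (-1) * g x" c] lin_ext_smult[of g c "-1"] assms
  by (simp add: fun_diff_def)

text \<open>These are the shapes in which the bilinearity, balancing and multilinearity relations
  are written, so killing a relation becomes an identity between values of \<open>c\<close>.\<close>

lemma lin_ext_rels [simp]: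
  "lin_ext c (single x - single y) = c x - c y"
  "lin_ext c (single x - single y - single z) = c x - c y - c z"
  "lin_ext c (single x - (\<lambda>w. a * single y w)) = c x - a * c y"
  by (simp_all add: lin_ext_diff lin_ext_smult finite_support del: minus_apply)

text \<open>Every coefficient of the image is a functional of the kind just treated, so linearity of
  \<open>free_map\<close> is inherited coefficientwise.\<close>

lemma free_map_eq_lin_ext:
  assumes "finite {x. f x \<noteq> 0}"
  shows "free_map \<phi> f = (\<lambda>y. lin_ext (\<lambda>x. single (\<phi> x) y) f)"
proof
  fix y
  have "(\<Sum>x\<in>{x. f x \<noteq> 0 \<and> \<phi> x = y}. f x) = (\<Sum>x\<in>{x \<in> {x. f x \<noteq> 0}. \<phi> x = y}. f x)"
    by (rule sum.cong) auto
  also have "\<dots> = (\<Sum>x\<in>{x. f x \<noteq> 0}. if \<phi> x = y then f x else 0)"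
    using assms by (rule sum.inter_filter)
  also have "\<dots> = lin_ext (\<lambda>x. single (\<phi> x) y) f"
    unfolding lin_ext_def by (rule sum.cong) (auto simp: single_def)
  finally show "free_map \<phi> f y = lin_ext (\<lambda>x. single (\<phi> x) y) f"
    by (simp add: free_map_def)
qed

lemma free_map_zero [simp]: "free_map \<phi> (\<lambda>x. 0) = (\<lambda>x. 0)"
  by (simp add: free_map_def)

lemma free_map_single [simp]: "free_map \<phi> (single x) = single (\<phi> x)"
  using free_map_eq_lin_ext[of "single x" \<phi>] by (simp add: finite_support)

lemma free_map_add:
  assumes "finite {x. f x \<noteq> 0}" "finite {x. g x \<noteq> 0}"
  shows "free_map \<phi> (\<lambda>x. f x + g x) = (\<lambda>y. free_map \<phi> f y + free_map \<phi> g y)"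
  using assms by (simp add: free_map_eq_lin_ext finite_support lin_ext_add)

lemma free_map_smult:
  assumes "finite {x. f x \<noteq> 0}"
  shows "free_map \<phi> (\<lambda>x. a * f x) = (\<lambda>y. a * free_map \<phi> f y)"
  using assms by (simp add: free_map_eq_lin_ext finite_support lin_ext_smult)

lemma free_map_diff:
  assumes "finite {x. f x \<noteq> 0}" "finite {x. g x \<noteq> 0}"
  shows "free_map \<phi> (f - g) = free_map \<phi> f - free_map \<phi> g"
proof -
  have "(\<lambda>x. f x + (-1) * g x) = f - g" by auto
  then show ?thesis
    using free_map_add[of f "\<lambda>x. (-1) * g x" \<phi>] free_map_smult[of g \<phi> "-1"] assms finite_support_smult[of g "-1"]
    by (simp add: fun_diff_def)
qed

lemma free_map_rels:
  "free_map \<phi> (single x - single y) = single (\<phi> x) - single (\<phi> y)"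
  "free_map \<phi> (single x - single y - single z) = single (\<phi> x) - single (\<phi> y) - single (\<phi> z)"
  "free_map \<phi> (single x - (\<lambda>w. a * single y w)) = single (\<phi> x) - (\<lambda>w. a * single (\<phi> y) w)"
  by (simp_all add: free_map_diff free_map_smult finite_support del: minus_apply)

text \<open>With \<open>N\<close> a span of relations, this reduces invariance of the span to a
  check on single relations.\<close>

lemma free_map_submodule:
  assumes N: "submodule class_ring N (free_space Y)"
  shows "submodule class_ring {f \<in> carrier (free_space X). free_map \<phi> f \<in> N} (free_space X)"
    (is "submodule _ ?N _")
proof (rule submodule.intro)
  show "module class_ring (free_space X)"
    using free_space_vectorspace by (rule vectorspace.axioms)
  show "f \<oplus>\<^bsub>free_space X\<^esub> g \<in> ?N" if "f \<in> ?N" "g \<in> ?N" for f g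
    using that submodule_free_add[OF N, of "free_map \<phi> f" "free_map \<phi> g"]
      free_space_finite_support[of f X] free_space_finite_support[of g X]
    by (simp add: free_space_add_closed free_map_add)
  show "c \<odot>\<^bsub>free_space X\<^esub> f \<in> ?N" if "f \<in> ?N" for c f
    using that submodule_free_smult[OF N, of "free_map \<phi> f" c] free_space_finite_support[of f X]
    by (simp add: free_space_smult_closed free_map_smult)
qed (use submodule.zero_closed[OF N] in \<open>auto simp: free_space_zero_closed\<close>)

lemma free_map_closed:
  assumes "\<phi> \<in> X \<rightarrow> Y" "f \<in> carrier (free_space X)"
  shows "free_map \<phi> f \<in> carrier (free_space Y)"
proof -
  interpret Y: vectorspace class_ring "free_space Y" by (rule free_space_vectorspace)
  have "submodule class_ring (carrier (free_space Y)) (free_space Y)"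
    by (rule submodule.intro) (use Y.module_axioms Y.M.a_closed Y.smult_closed Y.M.zero_closed in auto)
  from submodule_free_single[OF free_map_submodule[OF this] _ assms(2), of \<phi>]
  have "f \<in> {f \<in> carrier (free_space X). free_map \<phi> f \<in> carrier (free_space Y)}"
    using assms(1) by (simp add: image_subset_iff Pi_iff)
  then show ?thesis by simp
qed

text \<open>Bijectivity follows because the inverse group element acts as a two-sided inverse.
  Extensionality enters because \<open>BijGroup\<close> consists of extensional bijections.\<close>

lemma group_actionI:
  assumes "group G"
    and ext: "\<And>g. g \<in> carrier G \<Longrightarrow> \<rho> g \<in> extensional E"
    and closed: "\<And>g x. g \<in> carrier G \<Longrightarrow> x \<in> E \<Longrightarrow> \<rho> g x \<in> E"
    and mult: "\<And>g h x. g \<in> carrier G \<Longrightarrow> h \<in> carrier G \<Longrightarrow> x \<in> E \<Longrightarrow>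
                 \<rho> (g \<otimes>\<^bsub>G\<^esub> h) x = \<rho> g (\<rho> h x)"
    and one: "\<And>x. x \<in> E \<Longrightarrow> \<rho> \<one>\<^bsub>G\<^esub> x = x"
  shows "group_action G E \<rho>"
proof -
  interpret group G by fact
  have Bij: "\<rho> g \<in> Bij E" if g: "g \<in> carrier G" for g
  proof -
    have "bij_betw (\<rho> g) E E"
    proof (rule bij_betwI[where g = "\<rho> (inv\<^bsub>G\<^esub> g)"])
      show "\<rho> (inv\<^bsub>G\<^esub> g) (\<rho> g x) = x" if "x \<in> E" for x
        using mult[of "inv\<^bsub>G\<^esub> g" g x] g that one by simp
      show "\<rho> g (\<rho> (inv\<^bsub>G\<^esub> g) x) = x" if "x \<in> E" for x
        using mult[of g "inv\<^bsub>G\<^esub> g" x] g that one by simp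
    qed (use closed g in auto)
    then show ?thesis using ext[OF g] by (simp add: Bij_def)
  qed
  have "\<rho> (g \<otimes>\<^bsub>G\<^esub> h) = compose E (\<rho> g) (\<rho> h)" if "g \<in> carrier G" "h \<in> carrier G" for g h
    by (rule extensionalityI[of _ E])
      (use that ext mult in \<open>auto simp: compose_eq\<close>)
  then have "\<rho> \<in> hom G (BijGroup E)"
    using Bij by (intro homI) (auto simp: BijGroup_def)
  then show ?thesis
    by (intro group_action.intro group_hom.intro group_hom_axioms.intro group_BijGroup assms(1))
qed

section \<open>Free spaces modulo a span of relations\<close>

locale free_quotient =
  fixes X :: "'x set" and R :: "('x \<Rightarrow> 'k::field) set" and U :: "('x \<Rightarrow> 'k::field) set"
  assumes U_eq: "U = kspan (free_space X) R"
    and R: "R \<subseteq> carrier (free_space X)"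
begin

sublocale quotient_space "free_space X" U
  unfolding U_eq
  by (intro quotient_space.intro quotient_space_axioms.intro free_space_vectorspace
      module.span_is_submodule R vectorspace.axioms(1)[OF free_space_vectorspace])

lemma R_sub_U: "R \<subseteq> U"
  unfolding U_eq by (rule in_own_span[OF R])

lemma U_induct: "submodule class_ring N (free_space X) \<Longrightarrow> R \<subseteq> N \<Longrightarrow> U \<subseteq> N"
  unfolding U_eq by (rule span_is_subset)

abbreviation F :: "('k, 'x \<Rightarrow> 'k) module" where
  "F \<equiv> free_space X"

abbreviation cls :: "'x \<Rightarrow> ('x \<Rightarrow> 'k) set" where
  "cls x \<equiv> U +>\<^bsub>F\<^esub> single x"

lemma minus_free:
  assumes "f \<in> carrier F" "g \<in> carrier F"
  shows "f \<ominus>\<^bsub>F\<^esub> g = f - g"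
proof -
  have "\<ominus>\<^bsub>F\<^esub> g = (\<lambda>x. (-1) * g x)"
    using smult_minus_1[OF assms(2)] by (simp add: class_ring_simps)
  then show ?thesis by (simp add: a_minus_def fun_diff_def)
qed

lemma F_finite: "f \<in> carrier F \<Longrightarrow> finite {x. f x \<noteq> 0}"
  by (rule free_space_finite_support)

lemma coset_eqI:
  assumes "f \<in> carrier F" "g \<in> carrier F" "f - g \<in> U"
  shows "U +>\<^bsub>F\<^esub> f = U +>\<^bsub>F\<^esub> g"
  using assms by (simp add: coset_eq_iff minus_free)

lemma lin_ext_submodule:
  "submodule class_ring {f \<in> carrier F. lin_ext c f = 0} F"
  by (rule submodule.intro)
    (use module_axioms in \<open>auto simp: F_finite lin_ext_add lin_ext_smult
        free_space_add_closed free_space_smult_closed free_space_zero_closed\<close>)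

text \<open>\<open>c x i\<close> prescribes the coordinate at \<open>i\<close> of the generator
  \<open>x\<close>: \<open>kill\<close> lets it descend to the quotient, \<open>dual\<close> makes
  it a dual family, and \<open>gen\<close> yields spanning.\<close>

lemma coord_basis_quotient:
  assumes "finite I" and b: "b \<in> I \<rightarrow> X"
    and kill: "\<And>r i. r \<in> R \<Longrightarrow> i \<in> I \<Longrightarrow> lin_ext (\<lambda>x. c x i) r = 0"
    and dual: "\<And>i j. i \<in> I \<Longrightarrow> j \<in> I \<Longrightarrow> c (b j) i = (if i = j then 1 else 0)"
    and gen: "\<And>N x. submodule class_ring N F \<Longrightarrow> R \<subseteq> N \<Longrightarrow>
                (\<And>i. i \<in> I \<Longrightarrow> single (b i) \<in> N) \<Longrightarrow> x \<in> X \<Longrightarrow> single x \<in> N"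
  shows "\<exists>\<kappa>. coord_basis (quot_space F U) I (\<lambda>i. cls (b i)) \<kappa>"
proof -
  let ?Q = "quot_space F U"
  \<comment> \<open>A coset is evaluated at a chosen representative; the choice is harmless because
    the functional vanishes on \<open>U\<close>.\<close>
  define \<kappa> where "\<kappa> C i = lin_ext (\<lambda>x. c x i) (SOME f. f \<in> C)" for C i
  have kill': "lin_ext (\<lambda>x. c x i) u = 0" if "u \<in> U" "i \<in> I" for u i
    using U_induct[OF lin_ext_submodule[of "\<lambda>x. c x i"]] R kill that by blast
  have \<kappa>: "\<kappa> (U +>\<^bsub>F\<^esub> f) i = lin_ext (\<lambda>x. c x i) f" if f: "f \<in> carrier F" and i: "i \<in> I" for f i
  proof -
    have "(SOME g. g \<in> U +>\<^bsub>F\<^esub> f) \<in> U +>\<^bsub>F\<^esub> f"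
      using U.a_rcos_self[OF f] by (rule someI[of "\<lambda>g. g \<in> U +>\<^bsub>F\<^esub> f"])
    then obtain u where "u \<in> U" "(SOME g. g \<in> U +>\<^bsub>F\<^esub> f) = (\<lambda>x. u x + f x)"
      by (auto simp: a_r_coset_def')
    moreover have "u \<in> carrier F" using \<open>u \<in> U\<close> U_sub by auto
    ultimately show ?thesis
      using kill'[of u i] i f by (simp add: \<kappa>_def lin_ext_add F_finite)
  qed
  have "kspan ?Q ((\<lambda>f. U +>\<^bsub>F\<^esub> f) ` (\<lambda>i. single (b i)) ` I) = carrier ?Q"
  proof (rule quot_kspan_eqI)
    fix N f assume N: "submodule class_ring N F" "U \<subseteq> N" "(\<lambda>i. single (b i)) ` I \<subseteq> N"
      and f: "f \<in> carrier F"
    have "single ` X \<subseteq> N" using gen[OF N(1)] R_sub_U N(2,3) by blast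
    then show "f \<in> N" using submodule_free_single[OF N(1)] f by blast
  qed (use b in auto)
  then have "kspan ?Q ((\<lambda>i. cls (b i)) ` I) = carrier ?Q" by (simp add: image_image)
  moreover have "\<kappa> (x \<oplus>\<^bsub>?Q\<^esub> y) i = \<kappa> x i + \<kappa> y i"
    if x: "x \<in> carrier ?Q" and y: "y \<in> carrier ?Q" and i: "i \<in> I" for x y i
  proof -
    obtain v where v: "v \<in> carrier F" "x = U +>\<^bsub>F\<^esub> v" using x by (rule coset_cases)
    obtain w where w: "w \<in> carrier F" "y = U +>\<^bsub>F\<^esub> w" using y by (rule coset_cases)
    have "\<kappa> (x \<oplus>\<^bsub>?Q\<^esub> y) i = lin_ext (\<lambda>x. c x i) (\<lambda>z. v z + w z)"
      using coset_add[OF v(1) w(1)] \<kappa>[OF free_space_add_closed[OF v(1) w(1)] i]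
      by (simp only: v w free_space_simps)
    then show ?thesis
      using \<kappa>[OF v(1) i] \<kappa>[OF w(1) i] lin_ext_add[OF F_finite F_finite, OF v(1) w(1)]
      by (simp only: v w)
  qed
  moreover have "\<kappa> (a \<odot>\<^bsub>?Q\<^esub> x) i = a * \<kappa> x i" if x: "x \<in> carrier ?Q" and i: "i \<in> I" for x a i
  proof -
    obtain v where v: "v \<in> carrier F" "x = U +>\<^bsub>F\<^esub> v" using x by (rule coset_cases)
    have "\<kappa> (a \<odot>\<^bsub>?Q\<^esub> x) i = lin_ext (\<lambda>x. c x i) (\<lambda>z. a * v z)"
      using coset_smult[OF v(1), of a] \<kappa>[OF free_space_smult_closed[OF v(1)] i, of a]
      by (simp only: v free_space_simps)
    then show ?thesis
      using \<kappa>[OF v(1) i] lin_ext_smult[OF F_finite, OF v(1)] by (simp only: v)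
  qed
  moreover have "\<kappa> (cls (b j)) i = (if i = j then 1 else 0)" if "i \<in> I" "j \<in> I" for i j
  proof -
    have "b j \<in> X" using b that by auto
    then show ?thesis using \<kappa>[of "single (b j)" i] dual[of i j] that by simp
  qed
  moreover have "(\<lambda>i. cls (b i)) ` I \<subseteq> carrier ?Q" using b by (auto intro!: coset_closed)
  ultimately have "coord_basis ?Q I (\<lambda>i. cls (b i)) \<kappa>"
    unfolding coord_basis_def using \<open>finite I\<close> quot_vectorspace by blast
  then show ?thesis by blast
qed

section \<open>Group actions on the generators that descend to the quotient\<close>

context
  fixes G :: "('g, 'b) monoid_scheme" and \<phi> :: "'g \<Rightarrow> 'x \<Rightarrow> 'x"
  assumes G: "group G"
    and closed: "\<And>g x. g \<in> carrier G \<Longrightarrow> x \<in> X \<Longrightarrow> \<phi> g x \<in> X"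
    and mult: "\<And>g h x. g \<in> carrier G \<Longrightarrow> h \<in> carrier G \<Longrightarrow> x \<in> X \<Longrightarrow>
                 \<phi> (g \<otimes>\<^bsub>G\<^esub> h) x = \<phi> g (\<phi> h x)"
    and one: "\<And>x. x \<in> X \<Longrightarrow> \<phi> \<one>\<^bsub>G\<^esub> x = x"
    and rels: "\<And>g r. g \<in> carrier G \<Longrightarrow> r \<in> R \<Longrightarrow> free_map (\<phi> g) r \<in> U"
begin

text \<open>Invariance is assumed only for the relations. The preimage of \<open>U\<close> is a
  submodule containing them, hence contains \<open>U\<close>.\<close>

lemma quot_map_free_coset:
  assumes g: "g \<in> carrier G" and f: "f \<in> carrier F"
  shows "quot_map F U (free_map (\<phi> g)) (U +>\<^bsub>F\<^esub> f) =
    U +>\<^bsub>F\<^esub> free_map (\<phi> g) f"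
proof (rule quot_map_coset[OF f])
  have \<phi>: "\<phi> g \<in> X \<rightarrow> X" using closed g by auto
  show "free_map (\<phi> g) \<in> carrier F \<rightarrow> carrier F"
    using free_map_closed[OF \<phi>] by blast
  show "free_map (\<phi> g) (x \<oplus>\<^bsub>F\<^esub> y) = free_map (\<phi> g) x \<oplus>\<^bsub>F\<^esub> free_map (\<phi> g) y"
    if "x \<in> carrier F" "y \<in> carrier F" for x y :: "'x \<Rightarrow> 'k"
    using that by (simp add: F_finite free_map_add)
  show "free_map (\<phi> g) x \<in> U" if "x \<in> U" for x
    using U_induct[OF free_map_submodule[OF U]] R rels[OF g] that by blast
qed

text \<open>Both sides are linear in \<open>f\<close>, so agreement on generators suffices, and
  there it is the composition law of \<open>\<phi>\<close>.\<close>

lemma free_map_comp: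
  assumes "g \<in> carrier G" "h \<in> carrier G" "f \<in> carrier F"
  shows "free_map (\<phi> (g \<otimes>\<^bsub>G\<^esub> h)) f = free_map (\<phi> g) (free_map (\<phi> h) f)"
proof -
  interpret group G by (rule G)
  let ?N = "{f \<in> carrier F. free_map (\<phi> (g \<otimes>\<^bsub>G\<^esub> h)) f = free_map (\<phi> g) (free_map (\<phi> h) f)}"
  \<comment> \<open>Additivity of the outer map is available for finitely supported functions, so
    the inner image must be shown to be one.\<close>
  have fin: "finite {x. free_map (\<phi> h) f x \<noteq> 0}" if "f \<in> carrier F" for f :: "'x \<Rightarrow> 'k"
    using free_map_closed[of "\<phi> h" X X f] closed assms that by (auto simp: free_space_carrier)
  have "submodule class_ring ?N F"
  proof (rule submodule.intro)
    fix f f' assume "f \<in> ?N" "f' \<in> ?N"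
    then show "f \<oplus>\<^bsub>F\<^esub> f' \<in> ?N"
      using free_space_add_closed[of f X f'] fin[of f] fin[of f'] by (auto simp: free_map_add F_finite)
  next
    fix c f assume "f \<in> ?N"
    then show "c \<odot>\<^bsub>F\<^esub> f \<in> ?N"
      using free_space_smult_closed[of f X c] fin[of f] by (auto simp: free_map_smult F_finite)
  qed (use module_axioms in \<open>auto simp: free_space_zero_closed\<close>)
  then have "f \<in> ?N"
    by (rule submodule_free_single[OF _ _ assms(3)]) (use mult[OF assms(1,2)] in auto)
  then show ?thesis by simp
qed

lemma free_map_id:
  assumes "f \<in> carrier F"
  shows "free_map (\<phi> \<one>\<^bsub>G\<^esub>) f = f"
proof -
  let ?N = "{f \<in> carrier F. free_map (\<phi> \<one>\<^bsub>G\<^esub>) f = f}"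
  have "submodule class_ring ?N F"
  proof (rule submodule.intro)
    fix f f' assume "f \<in> ?N" "f' \<in> ?N"
    then show "f \<oplus>\<^bsub>F\<^esub> f' \<in> ?N"
      using free_space_add_closed[of f X f'] by (auto simp: free_map_add F_finite)
  next
    fix c f assume "f \<in> ?N"
    then show "c \<odot>\<^bsub>F\<^esub> f \<in> ?N"
      using free_space_smult_closed[of f X c] by (auto simp: free_map_smult F_finite)
  qed (use module_axioms in \<open>auto simp: free_space_zero_closed\<close>)
  then have "f \<in> ?N"
    by (rule submodule_free_single[OF _ _ assms]) (use one in auto)
  then show ?thesis by simp
qed

text \<open>An action on bare generators that respects the relations is enough. This yields both the
  translation action on an induced space and the diagonal action on a tensor product.\<close>

lemma linear_rep_quotient:
  "linear_rep G (quot_space F U) (\<lambda>g. quot_map F U (free_map (\<phi> g)))"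
proof -
  interpret group G by (rule G)
  let ?Q = "quot_space F U"
  let ?\<rho> = "\<lambda>g. quot_map F U (free_map (\<phi> g))"
  interpret Q: vectorspace class_ring ?Q by (rule quot_vectorspace)
  have fc: "free_map (\<phi> g) f \<in> carrier F" if "g \<in> carrier G" "f \<in> carrier F" for g and f :: "'x \<Rightarrow> 'k"
    using free_map_closed[of "\<phi> g" X X f] closed that by auto
  have "group_action G (carrier ?Q) ?\<rho>"
  proof (rule group_actionI[OF G])
    show "?\<rho> g \<in> extensional (carrier ?Q)" for g by (simp add: quot_map_def)
    show "?\<rho> g C \<in> carrier ?Q" if "g \<in> carrier G" "C \<in> carrier ?Q" for g C
      using that by (auto elim!: coset_cases simp: quot_map_free_coset coset_closed fc)
    show "?\<rho> (g \<otimes>\<^bsub>G\<^esub> h) C = ?\<rho> g (?\<rho> h C)"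
      if "g \<in> carrier G" "h \<in> carrier G" "C \<in> carrier ?Q" for g h C
      using that by (auto elim!: coset_cases simp: quot_map_free_coset fc free_map_comp)
    show "?\<rho> \<one>\<^bsub>G\<^esub> C = C" if "C \<in> carrier ?Q" for C
      using that by (auto elim!: coset_cases simp: quot_map_free_coset free_map_id)
  qed
  moreover have "linear_map class_ring ?Q ?Q (?\<rho> g)" if g: "g \<in> carrier G" for g
  proof -
    have "?\<rho> g \<in> LinearCombinations.module_hom class_ring ?Q ?Q"
      unfolding LinearCombinations.module_hom_def mem_Collect_eq
    proof (intro conjI allI impI)
      show "?\<rho> g \<in> carrier ?Q \<rightarrow> carrier ?Q"
        using g by (auto elim!: coset_cases simp: quot_map_free_coset coset_closed fc)
      show "?\<rho> g (C \<oplus>\<^bsub>?Q\<^esub> D) = ?\<rho> g C \<oplus>\<^bsub>?Q\<^esub> ?\<rho> g D" if CD: "C \<in> carrier ?Q \<and> D \<in> carrier ?Q" for C D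
      proof -
        obtain v where "v \<in> carrier F" "C = U +>\<^bsub>F\<^esub> v" using CD coset_cases by blast
        moreover obtain w where "w \<in> carrier F" "D = U +>\<^bsub>F\<^esub> w" using CD coset_cases by blast
        ultimately show ?thesis
          using g fc[OF g, of v] fc[OF g, of w] coset_add[of "free_map (\<phi> g) v" "free_map (\<phi> g) w"]
          by (simp add: coset_add quot_map_free_coset free_space_add_closed F_finite free_map_add)
      qed
      show "?\<rho> g (c \<odot>\<^bsub>?Q\<^esub> C) = c \<odot>\<^bsub>?Q\<^esub> ?\<rho> g C" if C: "c \<in> carrier class_ring \<and> C \<in> carrier ?Q" for c C
      proof -
        obtain v where "v \<in> carrier F" "C = U +>\<^bsub>F\<^esub> v" using C by (metis coset_cases)
        then show ?thesis
          using g fc[OF g, of v]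
          by (simp add: coset_smult quot_map_free_coset free_space_smult_closed F_finite free_map_smult)
      qed
    qed
    then show ?thesis
      by (intro linear_map.intro mod_hom.intro mod_hom_axioms.intro)
        (auto intro: quot_vectorspace Q.module_axioms)
  qed
  ultimately show ?thesis by (simp add: linear_rep_def quot_vectorspace)
qed

end
end

section \<open>Induced representations\<close>

lemma group_algebra_simps [simp]:
  "carrier (group_algebra G) = carrier (free_space (carrier G))"
  "\<zero>\<^bsub>group_algebra G\<^esub> = (\<lambda>x. 0)"
  "a \<oplus>\<^bsub>group_algebra G\<^esub> b = (\<lambda>x. a x + b x)"
  "c \<odot>\<^bsub>group_algebra G\<^esub> a = (\<lambda>x. c * a x)"
  by (simp_all add: group_algebra_def free_space_def)

lemma line_space_simps [simp]:
  "carrier line_space = UNIV" "x \<oplus>\<^bsub>line_space\<^esub> y = x + y" "c \<odot>\<^bsub>line_space\<^esub> x = c * x"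
  by (simp_all add: line_space_def)

section \<open>Convolution in the group algebra of a finite group\<close>

locale finite_group = group G for G (structure) +
  assumes finite_carrier: "finite (carrier G)"
begin

abbreviation KG :: "('k::field, 'a \<Rightarrow> 'k) module" where "KG \<equiv> group_algebra G"

lemma mult_eq_iff_div:
  assumes "g \<in> carrier G" "h \<in> carrier G" "z \<in> carrier G"
  shows "g \<otimes> h = z \<longleftrightarrow> g = z \<otimes> inv h"
  using assms by (metis inv_closed inv_solve_right)

text \<open>For fixed \<open>z\<close> and \<open>h\<close> only
  \<open>g = z \<otimes> inv h\<close> contributes. Extending both supports to the whole finite
  group first makes the index sets independent of \<open>a\<close> and \<open>b\<close>.\<close>

lemma group_algebra_mult:
  fixes a b :: "'a \<Rightarrow> 'k::field"
  assumes a: "a \<in> carrier (free_space (carrier G))" and b: "b \<in> carrier (free_space (carrier G))"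
  shows "a \<otimes>\<^bsub>KG\<^esub> b = (\<lambda>z. if z \<in> carrier G then \<Sum>h\<in>carrier G. a (z \<otimes> inv h) * b h else 0)"
proof
  fix z
  have "(a \<otimes>\<^bsub>KG\<^esub> b) z =
    (\<Sum>g\<in>{g. a g \<noteq> 0}. \<Sum>h\<in>{h. b h \<noteq> 0}. if g \<otimes> h = z then a g * b h else 0)"
    by (simp add: group_algebra_def)
  also have "\<dots> = (\<Sum>g\<in>{g. a g \<noteq> 0}. \<Sum>h\<in>carrier G. if g \<otimes> h = z then a g * b h else 0)"
    using b by (intro sum.cong sum.mono_neutral_left finite_carrier refl) (auto simp: free_space_carrier)
  also have "\<dots> = (\<Sum>g\<in>carrier G. \<Sum>h\<in>carrier G. if g \<otimes> h = z then a g * b h else 0)"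
    using a by (intro sum.mono_neutral_left finite_carrier) (auto simp: free_space_carrier intro!: sum.neutral)
  also have "\<dots> = (\<Sum>h\<in>carrier G. \<Sum>g\<in>carrier G. if g \<otimes> h = z then a g * b h else 0)"
    by (rule sum.swap)
  also have "\<dots> = (if z \<in> carrier G then \<Sum>h\<in>carrier G. a (z \<otimes> inv h) * b h else 0)"
  proof (cases "z \<in> carrier G")
    case True
    have "(\<Sum>g\<in>carrier G. if g \<otimes> h = z then a g * b h else 0) = a (z \<otimes> inv h) * b h"
      if h: "h \<in> carrier G" for h
    proof -
      have "(\<Sum>g\<in>carrier G. if g \<otimes> h = z then a g * b h else 0) =
        (\<Sum>g\<in>carrier G. if g = z \<otimes> inv h then a g * b h else 0)"
        using h True by (intro sum.cong) (auto simp: mult_eq_iff_div)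
      then show ?thesis using h True finite_carrier by simp
    qed
    then show ?thesis using True by simp
  next
    case False
    then have "g \<otimes> h \<noteq> z" if "g \<in> carrier G" "h \<in> carrier G" for g h using that by auto
    then show ?thesis using False by (simp add: sum.neutral)
  qed
  finally show "(a \<otimes>\<^bsub>KG\<^esub> b) z = (if z \<in> carrier G then \<Sum>h\<in>carrier G. a (z \<otimes> inv h) * b h else 0)" .
qed

lemma group_algebra_mult_closed:
  assumes "a \<in> carrier (free_space (carrier G))" "b \<in> carrier (free_space (carrier G))"
  shows "a \<otimes>\<^bsub>KG\<^esub> b \<in> carrier (free_space (carrier G))"
proof -
  have "{x. (a \<otimes>\<^bsub>KG\<^esub> b) x \<noteq> 0} \<subseteq> carrier G"
    using assms by (auto simp: group_algebra_mult split: if_splits)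
  then show ?thesis using finite_carrier finite_subset by (auto simp: free_space_carrier)
qed

lemma single_mult:
  assumes "g \<in> carrier G" "a \<in> carrier (free_space (carrier G))"
  shows "single g \<otimes>\<^bsub>KG\<^esub> a = (\<lambda>z. if z \<in> carrier G then a (inv g \<otimes> z) else 0)"
proof
  fix z
  show "(single g \<otimes>\<^bsub>KG\<^esub> a) z = (if z \<in> carrier G then a (inv g \<otimes> z) else 0)"
  proof (cases "z \<in> carrier G")
    case True
    have "z \<otimes> inv h = g \<longleftrightarrow> h = inv g \<otimes> z" if "h \<in> carrier G" for h
      using that True assms(1) by (metis inv_closed inv_solve_left inv_solve_right m_closed)
    then have "(\<Sum>h\<in>carrier G. single g (z \<otimes> inv h) * a h) =
      (\<Sum>h\<in>carrier G. if h = inv g \<otimes> z then a h else 0)"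
      by (intro sum.cong) (auto simp: single_def)
    then show ?thesis using True assms finite_carrier by (simp add: group_algebra_mult)
  qed (use assms in \<open>simp add: group_algebra_mult\<close>)
qed

lemma single_mult_single:
  assumes "g \<in> carrier G" "h \<in> carrier G"
  shows "single g \<otimes>\<^bsub>KG\<^esub> single h = single (g \<otimes> h)"
proof
  fix z
  have "inv g \<otimes> z = h \<longleftrightarrow> z = g \<otimes> h" if "z \<in> carrier G"
    using that assms by (metis inv_solve_left' m_closed)
  then show "(single g \<otimes>\<^bsub>KG\<^esub> single h) z = single (g \<otimes> h) z"
    using assms by (simp add: single_mult) (auto simp: single_def)
qed

text \<open>Associativity with a group element on the left says that translation commutes with right
  multiplication; this is what keeps the balancing relations invariant.\<close>

lemma single_mult_mult:
  assumes "g \<in> carrier G" "a \<in> carrier (free_space (carrier G))" "b \<in> carrier (free_space (carrier G))"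
  shows "single g \<otimes>\<^bsub>KG\<^esub> (a \<otimes>\<^bsub>KG\<^esub> b) = (single g \<otimes>\<^bsub>KG\<^esub> a) \<otimes>\<^bsub>KG\<^esub> b"
proof -
  have "single g \<otimes>\<^bsub>KG\<^esub> a \<in> carrier (free_space (carrier G))"
    using assms by (intro group_algebra_mult_closed) auto
  moreover have "inv g \<otimes> z \<otimes> inv h = inv g \<otimes> (z \<otimes> inv h)" if "z \<in> carrier G" "h \<in> carrier G" for z h
    using that assms(1) by (simp add: m_assoc)
  ultimately show ?thesis
    using assms group_algebra_mult_closed[OF assms(2,3)]
    by (auto simp: single_mult group_algebra_mult[of _ b] fun_eq_iff intro!: sum.cong)
qed

lemma single_one_mult:
  "a \<in> carrier (free_space (carrier G)) \<Longrightarrow> single \<one> \<otimes>\<^bsub>KG\<^esub> a = a"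
  by (auto simp: single_mult fun_eq_iff free_space_carrier)

end

section \<open>An induced space and its basis indexed by a transversal\<close>

locale induced = finite_group G for G (structure) +
  fixes W :: "'a set" and \<chi> :: "'a \<Rightarrow> 'k::field" and I :: "'a set"
  assumes W: "subgroup W G" and \<chi>: "one_dim_char (G\<lparr>carrier := W\<rparr>) \<chi>"
    and I: "left_transversal G W I"
begin

lemma W_sub: "w \<in> W \<Longrightarrow> w \<in> carrier G"
  using subgroup.subset[OF W] by auto

lemma I_sub: "i \<in> I \<Longrightarrow> i \<in> carrier G"
  using I by (auto simp: left_transversal_def)

lemma finite_W: "finite W" and finite_I: "finite I"
  using finite_subset[OF _ finite_carrier] W_sub I_sub by auto

lemma \<chi>_mult: "v \<in> W \<Longrightarrow> w \<in> W \<Longrightarrow> \<chi> (v \<otimes> w) = \<chi> v * \<chi> w"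
  using \<chi> by (auto simp: one_dim_char_def hom_def units_of_def)

lemma \<chi>_nonzero: "w \<in> W \<Longrightarrow> \<chi> w \<noteq> 0"
proof -
  assume "w \<in> W"
  then have "\<chi> w \<in> Units class_ring" using \<chi> by (auto simp: one_dim_char_def hom_def units_of_def)
  then show "\<chi> w \<noteq> 0" by (auto simp: Units_def)
qed

text \<open>A nonzero idempotent of a field is 1.\<close>

lemma \<chi>_one: "\<chi> \<one> = 1"
  using \<chi>_mult[of \<one> \<one>] \<chi>_nonzero[of \<one>] subgroup.one_closed[OF W] by simp

lemma transversal_cover:
  assumes "g \<in> carrier G"
  obtains i w where "i \<in> I" "w \<in> W" "g = i \<otimes> w"
proof -
  have "g <# W \<in> lcosets W" using assms by (auto simp: LCOSETS_def)
  then obtain i where "i \<in> I" "i \<in> g <# W" using I by (auto simp: left_transversal_def)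
  then obtain w where "w \<in> W" "i = g \<otimes> w" by (auto simp: l_coset_def)
  then have "inv w \<in> W" "g = i \<otimes> inv w"
    using subgroup.m_inv_closed[OF W] assms W_sub by (auto simp: m_assoc)
  then show ?thesis using that \<open>i \<in> I\<close> by blast
qed

text \<open>Both elements lie in \<open>i <# W\<close>, a coset that meets \<open>I\<close> exactly
  once.\<close>

lemma transversal_unique:
  assumes "i \<in> I" "j \<in> I" "w \<in> W" "j = i \<otimes> w"
  shows "i = j"
proof -
  have "i <# W \<in> lcosets W" using I_sub[OF assms(1)] by (auto simp: LCOSETS_def)
  then have "\<exists>!x. x \<in> I \<and> x \<in> i <# W" using I by (auto simp: left_transversal_def)
  moreover have "i \<in> i <# W" using I_sub[OF assms(1)] W by (rule lcos_self)
  moreover have "j \<in> i <# W" using assms by (auto simp: l_coset_def)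
  ultimately show ?thesis using assms by blast
qed

lemma char_action_eq:
  assumes "a \<in> carrier (free_space W)"
  shows "char_action \<chi> a y = (\<Sum>w\<in>W. a w * (\<chi> w * y))"
  unfolding char_action_def
  by (rule sum.mono_neutral_left[OF finite_W]) (use assms in \<open>auto simp: free_space_carrier\<close>)

lemma char_action_single: "char_action \<chi> (single w) y = \<chi> w * y"
  by (simp add: char_action_def single_def)

abbreviation X :: "(('a \<Rightarrow> 'k) \<times> 'k) set" where
  "X \<equiv> carrier (free_space (carrier G)) \<times> UNIV"

abbreviation rels :: "(('a \<Rightarrow> 'k) \<times> 'k \<Rightarrow> 'k) set" where
  "rels \<equiv> bal_rels (carrier (free_space W)) KG (\<otimes>\<^bsub>KG\<^esub>) line_space (char_action \<chi>)"

lemma ind_null_eq: "ind_null G W \<chi> = kspan (free_space X) rels"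
  by (simp add: ind_null_def bal_null_def)

lemma free_space_W_sub: "a \<in> carrier (free_space W) \<Longrightarrow> a \<in> carrier (free_space (carrier G))"
  using W_sub by (auto simp: free_space_carrier)

lemma rels_cases [consumes 1, case_names add_left add_right smult_left smult_right balance]:
  assumes "r \<in> rels"
  obtains x x' y where "x \<in> carrier (free_space (carrier G))" "x' \<in> carrier (free_space (carrier G))"
      "r = single (\<lambda>z. x z + x' z, y) - single (x, y) - single (x', y)"
  | x y y' where "x \<in> carrier (free_space (carrier G))"
      "r = single (x, y + y') - single (x, y) - single (x, y')"
  | c x y where "x \<in> carrier (free_space (carrier G))"
      "r = single (\<lambda>z. c * x z, y) - (\<lambda>z. c * single (x, y) z)"
  | c x y where "x \<in> carrier (free_space (carrier G))"
      "r = single (x, c * y) - (\<lambda>z. c * single (x, y) z)"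
  | x a y where "x \<in> carrier (free_space (carrier G))" "a \<in> carrier (free_space W)"
      "r = single (x \<otimes>\<^bsub>KG\<^esub> a, y) - single (x, char_action \<chi> a y)"
  using assms by (auto simp: bal_rels_def)

lemma rels_intros:
  "x \<in> carrier (free_space (carrier G)) \<Longrightarrow> x' \<in> carrier (free_space (carrier G)) \<Longrightarrow>
     single (\<lambda>z. x z + x' z, y) - single (x, y) - single (x', y) \<in> rels"
  "x \<in> carrier (free_space (carrier G)) \<Longrightarrow>
     single (x, y + y') - single (x, y) - single (x, y') \<in> rels"
  "x \<in> carrier (free_space (carrier G)) \<Longrightarrow>
     single (\<lambda>z. c * x z, y) - (\<lambda>z. c * single (x, y) z) \<in> rels"
  "x \<in> carrier (free_space (carrier G)) \<Longrightarrow>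
     single (x, c * y) - (\<lambda>z. c * single (x, y) z) \<in> rels"
  "x \<in> carrier (free_space (carrier G)) \<Longrightarrow> a \<in> carrier (free_space W) \<Longrightarrow>
     single (x \<otimes>\<^bsub>KG\<^esub> a, y) - single (x, char_action \<chi> a y) \<in> rels"
  unfolding bal_rels_def group_algebra_simps line_space_simps by blast+

sublocale free_quotient X rels "ind_null G W \<chi>"
proof (rule free_quotient.intro[OF ind_null_eq], rule subsetI)
  fix r assume "r \<in> rels"
  then show "r \<in> carrier (free_space X)"
    by (cases rule: rels_cases)
      (auto intro!: free_space_diff_closed free_space_smult_closed free_space_add_closed
        group_algebra_mult_closed dest: free_space_W_sub)
qed

lemma ind_space_eq: "ind_space G W \<chi> = quot_space F (ind_null G W \<chi>)"
  by (simp add: ind_space_def bal_tensor_def ind_null_def)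

lemma ind_vec_eq: "ind_vec G W \<chi> i = cls (single i, 1)"
  by (simp add: ind_vec_def)

lemma ind_action_eq:
  "ind_action G W \<chi> = (\<lambda>g. quot_map F (ind_null G W \<chi>)
     (free_map (\<lambda>(a, c). (single g \<otimes>\<^bsub>KG\<^esub> a, c))))"
  by (simp add: ind_action_def fun_eq_iff)

text \<open>The coefficient of \<open>a \<otimes> y\<close> at \<open>i \<otimes> 1\<close>, read off from \<open>i w \<otimes> y = i \<otimes> \<chi>(w) y\<close>.\<close>

definition ind_coord :: "('a \<Rightarrow> 'k) \<times> 'k \<Rightarrow> 'a \<Rightarrow> 'k" where
  "ind_coord p i = (\<Sum>w\<in>W. fst p (i \<otimes> w) * \<chi> w * snd p)"

text \<open>Both sides are sums over pairs \<open>w\<close>, \<open>h\<close> from \<open>W\<close>.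
  Replacing \<open>w\<close> by \<open>w \<otimes> h\<close> turns \<open>\<chi> w\<close> into
  \<open>\<chi> (w \<otimes> h)\<close>, which splits, and the factor \<open>\<chi> h\<close> is the
  action of \<open>h\<close> on the line.\<close>

lemma ind_coord_balance:
  assumes x: "x \<in> carrier (free_space (carrier G))" and a: "a \<in> carrier (free_space W)" and i: "i \<in> carrier G"
  shows "ind_coord (x \<otimes>\<^bsub>KG\<^esub> a, y) i = ind_coord (x, char_action \<chi> a y) i"
proof -
  have mult: "(x \<otimes>\<^bsub>KG\<^esub> a) (i \<otimes> w) = (\<Sum>h\<in>W. x (i \<otimes> (w \<otimes> inv h)) * a h)" if w: "w \<in> W" for w
  proof -
    have "(x \<otimes>\<^bsub>KG\<^esub> a) (i \<otimes> w) = (\<Sum>h\<in>carrier G. x (i \<otimes> w \<otimes> inv h) * a h)"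
      using i W_sub[OF w] by (simp add: group_algebra_mult[OF x free_space_W_sub[OF a]])
    \<comment> \<open>The convolution sum shrinks to \<open>W\<close> because \<open>a\<close> is
      supported there.\<close>
    also have "\<dots> = (\<Sum>h\<in>W. x (i \<otimes> w \<otimes> inv h) * a h)"
      by (rule sum.mono_neutral_right[OF finite_carrier]) (use W_sub a in \<open>auto simp: free_space_carrier\<close>)
    finally show ?thesis using i W_sub w by (simp add: m_assoc)
  qed
  have shift: "(\<Sum>w\<in>W. x (i \<otimes> (w \<otimes> inv h)) * \<chi> w) = (\<Sum>w\<in>W. x (i \<otimes> w) * \<chi> (w \<otimes> h))"
    if h: "h \<in> W" for h
    by (rule sum.reindex_bij_witness[of _ "\<lambda>w. w \<otimes> h" "\<lambda>w. w \<otimes> inv h"])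
      (use h W_sub in \<open>auto simp: m_assoc subgroup.m_closed[OF W] subgroup.m_inv_closed[OF W]\<close>)
  have "ind_coord (x \<otimes>\<^bsub>KG\<^esub> a, y) i = (\<Sum>w\<in>W. \<Sum>h\<in>W. x (i \<otimes> (w \<otimes> inv h)) * \<chi> w * (a h * y))"
    by (simp add: ind_coord_def mult sum_distrib_right sum_distrib_left algebra_simps)
  also have "\<dots> = (\<Sum>h\<in>W. (\<Sum>w\<in>W. x (i \<otimes> (w \<otimes> inv h)) * \<chi> w) * (a h * y))"
    by (subst sum.swap) (simp add: sum_distrib_right)
  also have "\<dots> = (\<Sum>h\<in>W. (\<Sum>w\<in>W. x (i \<otimes> w) * \<chi> (w \<otimes> h)) * (a h * y))"
    by (simp add: shift)
  also have "\<dots> = (\<Sum>h\<in>W. \<Sum>w\<in>W. x (i \<otimes> w) * \<chi> w * (a h * (\<chi> h * y)))"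
    by (simp add: \<chi>_mult sum_distrib_right sum_distrib_left algebra_simps)
  also have "\<dots> = (\<Sum>w\<in>W. \<Sum>h\<in>W. x (i \<otimes> w) * \<chi> w * (a h * (\<chi> h * y)))"
    by (rule sum.swap)
  also have "\<dots> = ind_coord (x, char_action \<chi> a y) i"
    by (simp add: ind_coord_def char_action_eq[OF a] sum_distrib_left)
  finally show ?thesis .
qed

lemma ind_coord_rels:
  assumes "r \<in> rels" "i \<in> I"
  shows "lin_ext (\<lambda>p. ind_coord p i) r = 0"
  using assms(1)
proof (cases rule: rels_cases)
  case (balance x a y)
  then show ?thesis using ind_coord_balance I_sub[OF assms(2)] by simp
qed (simp_all add: ind_coord_def sum.distrib sum_distrib_left sum_subtractf[symmetric] algebra_simps)

text \<open>By uniqueness of representatives \<open>i \<otimes> w = j\<close> forces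
  \<open>i = j\<close>, and then \<open>w\<close> is the identity, so at most the term with
  \<open>\<chi> \<one> = 1\<close> survives.\<close>

lemma ind_coord_dual:
  assumes "i \<in> I" "j \<in> I"
  shows "ind_coord (single j, 1) i = (if i = j then 1 else 0)"
proof -
  have "i \<otimes> w = j \<longleftrightarrow> i = j \<and> w = \<one>" if "w \<in> W" for w
    using transversal_unique[OF assms that] I_sub[OF assms(1)] W_sub[OF that] by (auto simp: eq_commute[of _ "i \<otimes> w"])
  then have "ind_coord (single j, 1) i = (\<Sum>w\<in>W. if w = \<one> then if i = j then 1 else 0 else 0)"
    unfolding ind_coord_def by (intro sum.cong) (auto simp: single_def \<chi>_one)
  then show ?thesis using finite_W subgroup.one_closed[OF W] by simp
qed

text \<open>Scalars in the second slot reduce the claim to pairs \<open>(a, 1)\<close>. Those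
  \<open>a\<close> for which the pair lies in \<open>N\<close> form a subspace of the group algebra,
  so it suffices to treat group elements, whose factor in \<open>W\<close> can cross the tensor
  sign.\<close>

lemma ind_generates:
  assumes N: "submodule class_ring N F" "rels \<subseteq> N"
    and vec: "\<And>i. i \<in> I \<Longrightarrow> single (single i, 1) \<in> N" and p: "p \<in> X"
  shows "single p \<in> N"
proof -
  let ?A = "free_space (carrier G) :: ('k, 'a \<Rightarrow> 'k) module"
  note R = rels_intros[THEN subsetD[OF N(2)]]
  have scale: "single (x, c) \<in> N" if "x \<in> carrier ?A" "single (x, 1) \<in> N" for x c
    using R(4)[OF that(1), of c 1] submodule_free_smult[OF N(1) that(2), of c]
    by (auto intro: submodule_free_diffD[OF N(1)])
  let ?M = "{a \<in> carrier ?A. single (a, 1) \<in> N}"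
  have "submodule class_ring ?M ?A"
  proof (rule submodule.intro)
    show "module class_ring ?A" using free_space_vectorspace by (rule vectorspace.axioms)
    show "a \<oplus>\<^bsub>?A\<^esub> b \<in> ?M" if "a \<in> ?M" "b \<in> ?M" for a b
      using R(1)[of a b 1] that
      by (auto intro: submodule_free_diffD[OF N(1)] free_space_add_closed)
    \<comment> \<open>The alternative \<open>c = 0\<close> delivers the zero vector without
      presupposing that any pair is already in \<open>N\<close>.\<close>
    have smult: "(\<lambda>z. c * a z) \<in> ?M" if "a \<in> carrier ?A" "c = 0 \<or> single (a, 1) \<in> N" for a c
    proof -
      have "(\<lambda>z. c * single (a, 1) z) \<in> N"
        using that(2) submodule_free_smult[OF N(1), of "single (a, 1)" c] submodule.zero_closed[OF N(1)] by auto
      then show ?thesis using R(3)[OF that(1), of c 1] that(1)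
        by (auto intro: submodule_free_diffD[OF N(1)] free_space_smult_closed)
    qed
    show "\<zero>\<^bsub>?A\<^esub> \<in> ?M" using smult[of "\<lambda>x. 0" 0] by (simp add: free_space_zero_closed)
    show "c \<odot>\<^bsub>?A\<^esub> a \<in> ?M" if "a \<in> ?M" for c a using smult[of a c] that by simp
  qed auto
  moreover have "single g \<in> ?M" if g: "g \<in> carrier G" for g
  proof -
    obtain i w where iw: "i \<in> I" "w \<in> W" "g = i \<otimes> w" using g by (rule transversal_cover)
    \<comment> \<open>Balancing moves \<open>w\<close> into the second slot, where it acts by a
      scalar; \<open>scale\<close> then absorbs that scalar.\<close>
    have "single (single g, 1) - single (single i, char_action \<chi> (single w) 1) \<in> N"
      using R(5)[of "single i" "single w" 1] iw I_sub W_sub by (simp add: single_mult_single)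
    moreover have "single (single i, char_action \<chi> (single w) 1) \<in> N"
      using scale[of "single i"] vec iw I_sub by simp
    ultimately show ?thesis using g by (auto intro: submodule_free_diffD[OF N(1)])
  qed
  then have "single ` carrier G \<subseteq> ?M" by blast
  ultimately have "a \<in> ?M" if "a \<in> carrier ?A" for a
    using submodule_free_single that by blast
  then show ?thesis using p scale by (cases p) auto
qed

lemma ind_coord_basis: "\<exists>\<kappa>. coord_basis (ind_space G W \<chi>) I (ind_vec G W \<chi>) \<kappa>"
  unfolding ind_space_eq ind_vec_eq
  by (rule coord_basis_quotient[where c = ind_coord])
    (use finite_I I_sub ind_coord_rels ind_coord_dual ind_generates in auto)

section \<open>The group action on an induced space\<close>

context
begin

private lemma
  shows act_closed: "\<And>g p. g \<in> carrier G \<Longrightarrow> p \<in> X \<Longrightarrow>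
      (case p of (a, c) \<Rightarrow> (single g \<otimes>\<^bsub>KG\<^esub> a, c)) \<in> X"
    and act_mult: "\<And>g h p. g \<in> carrier G \<Longrightarrow> h \<in> carrier G \<Longrightarrow> p \<in> X \<Longrightarrow>
      (case p of (a, c) \<Rightarrow> (single (g \<otimes> h) \<otimes>\<^bsub>KG\<^esub> a, c)) =
      (case case p of (a, c) \<Rightarrow> (single h \<otimes>\<^bsub>KG\<^esub> a, c) of (a, c) \<Rightarrow> (single g \<otimes>\<^bsub>KG\<^esub> a, c))"
    and act_one: "\<And>p. p \<in> X \<Longrightarrow> (case p of (a, c) \<Rightarrow> (single \<one> \<otimes>\<^bsub>KG\<^esub> a, c)) = p"
  by (auto simp: group_algebra_mult_closed single_mult_mult single_mult_single[symmetric] single_one_mult)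

text \<open>Left translation sends each relation to one of the same type: the bilinear ones by
  linearity of translation, the balancing ones because it commutes with right
  multiplication.\<close>

private lemma act_rels:
  assumes g: "g \<in> carrier G" and "r \<in> rels"
  shows "free_map (\<lambda>(a, c). (single g \<otimes>\<^bsub>KG\<^esub> a, c)) r \<in> ind_null G W \<chi>"
proof -
  have closed: "single g \<otimes>\<^bsub>KG\<^esub> a \<in> carrier (free_space (carrier G))"
    if "a \<in> carrier (free_space (carrier G))" for a :: "'a \<Rightarrow> 'k"
    using that g by (simp add: group_algebra_mult_closed)
  have add: "single g \<otimes>\<^bsub>KG\<^esub> (\<lambda>z. a z + b z) = (\<lambda>z. (single g \<otimes>\<^bsub>KG\<^esub> a) z + (single g \<otimes>\<^bsub>KG\<^esub> b) z)"
    if "a \<in> carrier (free_space (carrier G))" "b \<in> carrier (free_space (carrier G))" for a b :: "'a \<Rightarrow> 'k"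
    using that g by (auto simp: single_mult free_space_add_closed)
  have smult: "single g \<otimes>\<^bsub>KG\<^esub> (\<lambda>z. c * a z) = (\<lambda>z. c * (single g \<otimes>\<^bsub>KG\<^esub> a) z)"
    if "a \<in> carrier (free_space (carrier G))" for c and a :: "'a \<Rightarrow> 'k"
    using that g by (auto simp: single_mult free_space_smult_closed)
  from \<open>r \<in> rels\<close> have "free_map (\<lambda>(a, c). (single g \<otimes>\<^bsub>KG\<^esub> a, c)) r \<in> rels"
    by (cases rule: rels_cases)
      (simp_all only: free_map_rels add smult prod.case rels_intros closed free_space_W_sub
        single_mult_mult[OF g] )
  then show ?thesis using R_sub_U by blast
qed

lemma ind_linear_rep: "linear_rep G (ind_space G W \<chi>) (ind_action G W \<chi>)"
  unfolding ind_space_eq ind_action_eq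
  by (rule linear_rep_quotient[OF is_group act_closed act_mult act_one act_rels])

lemma ind_action_vec:
  assumes z: "z \<in> carrier G" and i: "i \<in> I"
  shows "trans_action G W I z i \<in> I" "trans_coeff G W \<chi> I i z \<noteq> 0"
    "ind_action G W \<chi> z (ind_vec G W \<chi> i) =
      trans_coeff G W \<chi> I i z \<odot>\<^bsub>ind_space G W \<chi>\<^esub> ind_vec G W \<chi> (trans_action G W I z i)"
proof -
  define j where "j = trans_action G W I z i"
  define w where "w = inv j \<otimes> z \<otimes> i"
  \<comment> \<open>The description by \<open>THE\<close> has a unique witness, the representative
    of the coset of \<open>z \<otimes> i\<close>.\<close>
  have "j \<in> I \<and> w \<in> W"
    using theI'[OF trans_action_ex1[OF is_group W I z i]] by (simp add: w_def j_def trans_action_def)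
  then have j: "j \<in> I" and w: "w \<in> W" by auto
  show "trans_action G W I z i \<in> I" using j by (simp add: j_def)
  have coeff: "trans_coeff G W \<chi> I i z = \<chi> w" by (simp add: trans_coeff_def w_def j_def)
  show "trans_coeff G W \<chi> I i z \<noteq> 0" using \<chi>_nonzero[OF w] coeff by simp
  have G: "i \<in> carrier G" "j \<in> carrier G" "w \<in> carrier G" using I_sub i j W_sub w by auto
  have zi: "z \<otimes> i = j \<otimes> w" using G z by (simp add: w_def m_assoc[symmetric])
  have "ind_action G W \<chi> z (ind_vec G W \<chi> i) =
      ind_null G W \<chi> +>\<^bsub>F\<^esub> free_map (\<lambda>(a, c). (single z \<otimes>\<^bsub>KG\<^esub> a, c)) (single (single i, 1))"
    unfolding ind_action_eq ind_vec_eq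
    by (rule quot_map_free_coset[OF is_group act_closed act_mult act_one act_rels z]) (use G in simp_all)
  also have "\<dots> = cls (single j \<otimes>\<^bsub>KG\<^esub> single w, 1)"
    using G z by (simp add: single_mult_single zi)
  also have "\<dots> = cls (single j, \<chi> w * 1)"
    using rels_intros(5)[of "single j" "single w" 1] R_sub_U G w
    by (intro coset_eqI) (auto simp: char_action_single group_algebra_mult_closed)
  \<comment> \<open>A generator with a scaled entry and the scaled generator are in general
    different elements of the free space; homogeneity in the second slot identifies their
    classes.\<close>
  also have "\<dots> = ind_null G W \<chi> +>\<^bsub>F\<^esub> (\<lambda>p. \<chi> w * single (single j, 1) p)"
    using rels_intros(4)[of "single j" "\<chi> w" 1] R_sub_U G
    by (intro coset_eqI) (auto intro: free_space_smult_closed)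
  also have "\<dots> = \<chi> w \<odot>\<^bsub>ind_space G W \<chi>\<^esub> ind_vec G W \<chi> j"
    using G coset_smult[of "single (single j, 1)" "\<chi> w"] by (simp add: ind_space_eq ind_vec_eq)
  finally show "ind_action G W \<chi> z (ind_vec G W \<chi> i) =
      trans_coeff G W \<chi> I i z \<odot>\<^bsub>ind_space G W \<chi>\<^esub> ind_vec G W \<chi> (trans_action G W I z i)"
    by (simp add: coeff j_def)
qed

end

end

section \<open>Tensor products\<close>

locale tensor_product =
  fixes J :: "'i set" and V :: "'i \<Rightarrow> ('k::field, 'v) module"
  assumes finite_J: "finite J" and vs: "\<And>j. j \<in> J \<Longrightarrow> vectorspace class_ring (V j)"
begin

abbreviation X :: "('i \<Rightarrow> 'v) set" where "X \<equiv> (\<Pi>\<^sub>E j\<in>J. carrier (V j))"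

lemma V_add_closed:
  "j \<in> J \<Longrightarrow> x \<in> carrier (V j) \<Longrightarrow> y \<in> carrier (V j) \<Longrightarrow> x \<oplus>\<^bsub>V j\<^esub> y \<in> carrier (V j)"
proof -
  assume "j \<in> J"
  then interpret vectorspace class_ring "V j" by (rule vs)
  show "x \<in> carrier (V j) \<Longrightarrow> y \<in> carrier (V j) \<Longrightarrow> x \<oplus>\<^bsub>V j\<^esub> y \<in> carrier (V j)" by simp
qed

lemma V_smult_closed: "j \<in> J \<Longrightarrow> x \<in> carrier (V j) \<Longrightarrow> c \<odot>\<^bsub>V j\<^esub> x \<in> carrier (V j)"
proof -
  assume "j \<in> J"
  then interpret vectorspace class_ring "V j" by (rule vs)
  show "x \<in> carrier (V j) \<Longrightarrow> c \<odot>\<^bsub>V j\<^esub> x \<in> carrier (V j)" by simp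
qed

lemma X_upd: "v \<in> X \<Longrightarrow> j \<in> J \<Longrightarrow> x \<in> carrier (V j) \<Longrightarrow> v(j := x) \<in> X"
  by (auto simp: PiE_iff extensional_def)

lemma rels_cases [consumes 1, case_names add smult]:
  assumes "r \<in> tensor_rels J V"
  obtains v j x y where "v \<in> X" "j \<in> J" "x \<in> carrier (V j)" "y \<in> carrier (V j)"
      "r = single (v(j := x \<oplus>\<^bsub>V j\<^esub> y)) - single (v(j := x)) - single (v(j := y))"
  | v j c x where "v \<in> X" "j \<in> J" "x \<in> carrier (V j)"
      "r = single (v(j := c \<odot>\<^bsub>V j\<^esub> x)) - (\<lambda>z. c * single (v(j := x)) z)"
  using assms unfolding tensor_rels_def by blast

lemma rels_intros:
  "v \<in> X \<Longrightarrow> j \<in> J \<Longrightarrow> x \<in> carrier (V j) \<Longrightarrow> y \<in> carrier (V j) \<Longrightarrow>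
     single (v(j := x \<oplus>\<^bsub>V j\<^esub> y)) - single (v(j := x)) - single (v(j := y)) \<in> tensor_rels J V"
  "v \<in> X \<Longrightarrow> j \<in> J \<Longrightarrow> x \<in> carrier (V j) \<Longrightarrow>
     single (v(j := c \<odot>\<^bsub>V j\<^esub> x)) - (\<lambda>z. c * single (v(j := x)) z) \<in> tensor_rels J V"
  unfolding tensor_rels_def by blast+

sublocale free_quotient X "tensor_rels J V" "tensor_null J V"
proof (rule free_quotient.intro[OF tensor_null_def], rule subsetI)
  fix r assume "r \<in> tensor_rels J V"
  then show "r \<in> carrier (free_space X)"
    by (cases rule: rels_cases)
      (simp_all add: free_space_diff_closed free_space_smult_closed X_upd V_add_closed V_smult_closed)
qed

lemma tensor_space_eq: "tensor_space J V = quot_space F (tensor_null J V)"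
  by (simp add: tensor_space_def)

lemma pure_tensor_eq: "pure_tensor J V v = cls (restrict v J)"
  by (simp add: pure_tensor_def)

section \<open>A basis of the tensor product from coordinates on the factors\<close>

context
  fixes I :: "'i \<Rightarrow> 'b set" and e :: "'i \<Rightarrow> 'b \<Rightarrow> 'v" and \<kappa> :: "'i \<Rightarrow> 'v \<Rightarrow> 'b \<Rightarrow> 'k"
  assumes cb: "\<And>j. j \<in> J \<Longrightarrow> coord_basis (V j) (I j) (e j) (\<kappa> j)"
begin

definition tensor_coord :: "('i \<Rightarrow> 'v) \<Rightarrow> ('i \<Rightarrow> 'b) \<Rightarrow> 'k" where
  "tensor_coord v i = (\<Prod>j\<in>J. \<kappa> j (v j) (i j))"

text \<open>Splitting off slot \<open>j\<close> exhibits the dependence on that slot through one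
  functional, with a remaining factor that the update leaves alone.\<close>

lemma tensor_coord_upd:
  assumes "j \<in> J"
  shows "tensor_coord (v(j := x)) i = \<kappa> j x (i j) * (\<Prod>l\<in>J - {j}. \<kappa> l (v l) (i l))"
proof -
  have "(\<Prod>l\<in>J - {j}. \<kappa> l ((v(j := x)) l) (i l)) = (\<Prod>l\<in>J - {j}. \<kappa> l (v l) (i l))"
    by (rule prod.cong) auto
  then show ?thesis unfolding tensor_coord_def by (simp add: prod.remove[OF finite_J assms])
qed

lemma tensor_coord_rels:
  assumes "r \<in> tensor_rels J V" and i: "i \<in> (\<Pi>\<^sub>E j\<in>J. I j)"
  shows "lin_ext (\<lambda>v. tensor_coord v i) r = 0"
  using assms(1)
proof (cases rule: rels_cases)
  case (add v j x y)
  then have "\<kappa> j (x \<oplus>\<^bsub>V j\<^esub> y) (i j) = \<kappa> j x (i j) + \<kappa> j y (i j)"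
    using cb[OF add(2)] i by (auto simp: coord_basis_def PiE_iff)
  then show ?thesis using add(2,5) by (simp add: tensor_coord_upd algebra_simps)
next
  case (smult v j c x)
  then have "\<kappa> j (c \<odot>\<^bsub>V j\<^esub> x) (i j) = c * \<kappa> j x (i j)"
    using cb[OF smult(2)] i by (auto simp: coord_basis_def PiE_iff)
  then show ?thesis using smult(2,4) by (simp add: tensor_coord_upd)
qed

text \<open>A product of Kronecker deltas. Index tuples are extensional, so distinct ones differ at
  some position in \<open>J\<close>, and the product acquires a zero there.\<close>

lemma tensor_coord_dual:
  assumes i: "i \<in> (\<Pi>\<^sub>E j\<in>J. I j)" and i': "i' \<in> (\<Pi>\<^sub>E j\<in>J. I j)"
  shows "tensor_coord (\<lambda>j\<in>J. e j (i' j)) i = (if i = i' then 1 else 0)"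
proof -
  have "tensor_coord (\<lambda>j\<in>J. e j (i' j)) i = (\<Prod>j\<in>J. if i j = i' j then 1 else 0)"
    unfolding tensor_coord_def
  proof (rule prod.cong)
    fix j assume "j \<in> J"
    then show "\<kappa> j ((\<lambda>j\<in>J. e j (i' j)) j) (i j) = (if i j = i' j then 1 else 0)"
      using cb[of j] i i' by (auto simp: coord_basis_def PiE_iff)
  qed simp
  also have "\<dots> = (if i = i' then 1 else 0)"
  proof (cases "i = i'")
    case False
    then obtain j where "j \<in> J" "i j \<noteq> i' j" using i i' by (metis PiE_ext)
    then show ?thesis using False finite_J by (auto intro!: prod_zero)
  qed simp
  finally show ?thesis .
qed

text \<open>Expands the factors with index in \<open>A\<close> one at a time by multilinearity.\<close>

lemma tensor_generates:
  assumes N: "submodule class_ring N F" "tensor_rels J V \<subseteq> N"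
    and vec: "\<And>i. i \<in> (\<Pi>\<^sub>E j\<in>J. I j) \<Longrightarrow> single (\<lambda>j\<in>J. e j (i j)) \<in> N"
    and "finite A" "A \<subseteq> J" "v \<in> X" "\<And>j. j \<in> J - A \<Longrightarrow> v j \<in> e j ` I j"
  shows "single v \<in> N"
  using assms(4-)
proof (induction A arbitrary: v rule: finite_induct)
  case empty
  then have "\<forall>j\<in>J. \<exists>i. i \<in> I j \<and> v j = e j i" by auto
  then obtain i where i: "\<And>j. j \<in> J \<Longrightarrow> i j \<in> I j \<and> v j = e j (i j)" by metis
  \<comment> \<open>The chosen indices are arbitrary off \<open>J\<close>; restriction makes them a
    legal index tuple.\<close>
  have "v = (\<lambda>j\<in>J. e j (restrict i J j))"
    using i empty.prems(2) by (auto simp: fun_eq_iff PiE_iff extensional_def)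
  moreover have "restrict i J \<in> (\<Pi>\<^sub>E j\<in>J. I j)" using i by auto
  ultimately show ?case using vec by metis
next
  case (insert a A)
  note R = rels_intros[THEN subsetD[OF N(2)]]
  have a: "a \<in> J" and v: "v \<in> X" using insert.prems by auto
  interpret Va: vectorspace class_ring "V a" using a by (rule vs)
  have "v a \<in> carrier (V a)" using a v by auto
  \<comment> \<open>Writing the entry as an update keeps \<open>v\<close> fixed while the value in
    slot \<open>a\<close> varies in an inner induction over that factor.\<close>
  with cb[OF a] have "single (v(a := v a)) \<in> N"
  proof (induction rule: coord_basis_induct)
    case zero
    \<comment> \<open>A tuple with a zero entry is, by homogeneity in that slot with scalar 0, equal
      to zero modulo \<open>N\<close>.\<close>
    have "(\<lambda>z. 0 * single (v(a := \<zero>\<^bsub>V a\<^esub>)) z) \<in> N" using submodule.zero_closed[OF N(1)] by simp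
    with R(2)[OF v a Va.M.zero_closed, of 0]
    have "single (v(a := 0 \<odot>\<^bsub>V a\<^esub> \<zero>\<^bsub>V a\<^esub>)) \<in> N" by (rule submodule_free_diffD[OF N(1)])
    moreover have "0 \<odot>\<^bsub>V a\<^esub> \<zero>\<^bsub>V a\<^esub> = \<zero>\<^bsub>V a\<^esub>" using Va.lmult_0[OF Va.M.zero_closed] by simp
    ultimately show ?case by metis
  next
    case (basis i)
    have "e a i \<in> carrier (V a)" using cb[OF a] basis by (auto simp: coord_basis_def)
    \<comment> \<open>Slot \<open>a\<close> now holds a basis vector, so arbitrary entries remain
      only in \<open>A\<close> and the outer induction hypothesis applies.\<close>
    then show ?case
      using insert.prems basis by (intro insert.IH X_upd[OF v a]) auto
  next
    case (add x y)
    show ?case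
      by (rule submodule_free_diffD[OF N(1) submodule_free_diffD[OF N(1) R(1)[OF v a add(1,2)] add(4)] add(3)])
  next
    case (smult c x)
    show ?case
      by (rule submodule_free_diffD[OF N(1) R(2)[OF v a smult(1)] submodule_free_smult[OF N(1) smult(2)]])
  qed
  then show ?case by simp
qed

lemma tensor_coord_basis:
  "\<exists>\<kappa>'. coord_basis (tensor_space J V) (\<Pi>\<^sub>E j\<in>J. I j) (\<lambda>i. pure_tensor J V (\<lambda>j. e j (i j))) \<kappa>'"
  unfolding tensor_space_eq pure_tensor_eq
proof (rule coord_basis_quotient[where c = tensor_coord])
  show "finite (\<Pi>\<^sub>E j\<in>J. I j)" using cb finite_J by (auto intro!: finite_PiE simp: coord_basis_def)
  show "(\<lambda>i. \<lambda>j\<in>J. e j (i j)) \<in> (\<Pi>\<^sub>E j\<in>J. I j) \<rightarrow> X"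
    using cb unfolding coord_basis_def by (fastforce simp: PiE_iff)
  show "single v \<in> N" if "submodule class_ring N F" "tensor_rels J V \<subseteq> N"
    "\<And>i. i \<in> (\<Pi>\<^sub>E j\<in>J. I j) \<Longrightarrow> single (\<lambda>j\<in>J. e j (i j)) \<in> N" "v \<in> X" for N v
    by (rule tensor_generates[OF that(1-3) finite_J subset_refl that(4)]) auto
qed (use tensor_coord_rels tensor_coord_dual in auto)

end

section \<open>Scalars in pure tensors\<close>

lemma cls_upd_smult:
  assumes "v \<in> X" "j \<in> J" "x \<in> carrier (V j)"
  shows "cls (v(j := c \<odot>\<^bsub>V j\<^esub> x)) = c \<odot>\<^bsub>tensor_space J V\<^esub> cls (v(j := x))"
proof -
  have "cls (v(j := c \<odot>\<^bsub>V j\<^esub> x)) = tensor_null J V +>\<^bsub>F\<^esub> (\<lambda>z. c * single (v(j := x)) z)"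
  proof (rule coset_eqI)
    show "single (v(j := c \<odot>\<^bsub>V j\<^esub> x)) - (\<lambda>z. c * single (v(j := x)) z) \<in> tensor_null J V"
      using rels_intros(2)[OF assms] R_sub_U by blast
  qed (simp_all add: assms free_space_smult_closed X_upd V_smult_closed)
  then show ?thesis
    using coset_smult[of "single (v(j := x))" c] X_upd[OF assms] by (simp add: tensor_space_eq)
qed

lemma pure_tensor_smult:
  assumes x: "\<And>j. j \<in> J \<Longrightarrow> x j \<in> carrier (V j)"
  shows "pure_tensor J V (\<lambda>j. c j \<odot>\<^bsub>V j\<^esub> x j) =
    (\<Prod>j\<in>J. c j) \<odot>\<^bsub>tensor_space J V\<^esub> pure_tensor J V x"
proof -
  interpret T: vectorspace class_ring "tensor_space J V"
    unfolding tensor_space_eq by (rule quot_vectorspace)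
  \<comment> \<open>Homogeneity handles one slot at a time, so \<open>y A\<close> interpolates
    between the plain tuple at \<open>{}\<close> and the fully scaled one at
    \<open>J\<close>.\<close>
  define y where "y A = (\<lambda>j\<in>J. if j \<in> A then c j \<odot>\<^bsub>V j\<^esub> x j else x j)" for A
  have yX: "y A \<in> X" for A using x by (auto simp: y_def V_smult_closed)
  define x' where "x' = restrict x J"
  have xX: "x' \<in> X" using x by (auto simp: x'_def)
  have clsT: "cls v \<in> carrier (tensor_space J V)" if "v \<in> X" for v
    using that by (simp add: tensor_space_eq coset_closed)
  have "cls (y A) = (\<Prod>j\<in>A. c j) \<odot>\<^bsub>tensor_space J V\<^esub> cls x'"
    if "finite A" "A \<subseteq> J" for A
    using that
  proof (induction A rule: finite_induct)
    case empty
    have "y {} = x'" by (simp add: y_def x'_def)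
    then show ?case using T.smult_one[OF clsT[OF xX]] by (simp only: prod.empty monoid.select_convs)
  next
    case (insert a A)
    then have "a \<in> J" "y (insert a A) = (y A)(a := c a \<odot>\<^bsub>V a\<^esub> x a)" "y A = (y A)(a := x a)"
      by (auto simp: y_def fun_eq_iff)
    then have "cls (y (insert a A)) = c a \<odot>\<^bsub>tensor_space J V\<^esub> cls (y A)"
      using cls_upd_smult[OF yX[of A], of a "x a" "c a"] x by simp
    also have "\<dots> = (c a * (\<Prod>j\<in>A. c j)) \<odot>\<^bsub>tensor_space J V\<^esub> cls x'"
      using insert T.smult_assoc1[of "c a" "\<Prod>j\<in>A. c j"] clsT[OF xX] by simp
    finally show ?case using insert by simp
  qed
  from this[OF finite_J subset_refl] show ?thesis
    by (simp add: pure_tensor_eq y_def x'_def cong: restrict_cong)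
qed

section \<open>The diagonal action\<close>

context
  fixes G :: "('g, 'b) monoid_scheme" and \<rho> :: "'i \<Rightarrow> 'g \<Rightarrow> 'v \<Rightarrow> 'v"
  assumes G: "group G" and rep: "\<And>j. j \<in> J \<Longrightarrow> linear_rep G (V j) (\<rho> j)"
begin

private lemma \<rho>_action: "j \<in> J \<Longrightarrow> group_action G (carrier (V j)) (\<rho> j)"
  using rep by (simp add: linear_rep_def)

private lemma \<rho>_closed: "j \<in> J \<Longrightarrow> g \<in> carrier G \<Longrightarrow> x \<in> carrier (V j) \<Longrightarrow> \<rho> j g x \<in> carrier (V j)"
  using group_action.element_image[OF \<rho>_action] by blast

private lemma \<rho>_hom:
  assumes "j \<in> J" "g \<in> carrier G"
  shows "\<rho> j g \<in> LinearCombinations.module_hom class_ring (V j) (V j)"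
proof -
  interpret linear_map class_ring "V j" "V j" "\<rho> j g"
    using rep assms by (auto simp: linear_rep_def)
  show ?thesis by (rule f_hom)
qed

private lemma act_closed:
  "g \<in> carrier G \<Longrightarrow> v \<in> X \<Longrightarrow> (\<lambda>j\<in>J. \<rho> j g (v j)) \<in> X"
  using \<rho>_closed by auto

private lemma act_mult:
  assumes "g \<in> carrier G" "h \<in> carrier G" "v \<in> X"
  shows "(\<lambda>j\<in>J. \<rho> j (g \<otimes>\<^bsub>G\<^esub> h) (v j)) = (\<lambda>j\<in>J. \<rho> j g ((\<lambda>j\<in>J. \<rho> j h (v j)) j))"
  using assms group_action.composition_rule[OF \<rho>_action] by (auto simp: fun_eq_iff PiE_iff)

private lemma act_one:
  assumes v: "v \<in> X"
  shows "(\<lambda>j\<in>J. \<rho> j \<one>\<^bsub>G\<^esub> (v j)) = v"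
proof
  fix j
  show "(\<lambda>j\<in>J. \<rho> j \<one>\<^bsub>G\<^esub> (v j)) j = v j"
  proof (cases "j \<in> J")
    case True
    then show ?thesis
      using v group_action.id_eq_one[OF \<rho>_action[OF True]] by (metis PiE_mem restrict_apply')
  qed (use v in \<open>auto simp: PiE_iff extensional_def\<close>)
qed

text \<open>Acting on all slots and then updating slot \<open>j\<close> with
  \<open>\<rho> j g x\<close> is the same as updating with \<open>x\<close> and then acting.
  Linearity of \<open>\<rho> j g\<close> therefore carries a relation in slot \<open>j\<close> to a
  relation in slot \<open>j\<close>.\<close>

private lemma act_rels:
  assumes g: "g \<in> carrier G" and "r \<in> tensor_rels J V"
  shows "free_map (\<lambda>v. \<lambda>j\<in>J. \<rho> j g (v j)) r \<in> tensor_null J V"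
proof -
  have upd: "(\<lambda>l\<in>J. \<rho> l g ((v(j := x)) l)) = (\<lambda>l\<in>J. \<rho> l g (v l))(j := \<rho> j g x)"
    if "j \<in> J" for v j x using that by (auto simp: fun_eq_iff)
  from \<open>r \<in> tensor_rels J V\<close> have "free_map (\<lambda>v. \<lambda>j\<in>J. \<rho> j g (v j)) r \<in> tensor_rels J V"
  proof (cases rule: rels_cases)
    case (add v j x y)
    then show ?thesis
      using rels_intros(1)[OF act_closed[OF g add(1)] add(2) \<rho>_closed[OF add(2) g add(3)] \<rho>_closed[OF add(2) g add(4)]]
        LinearCombinations.module_hom_add[OF \<rho>_hom[OF add(2) g] add(3,4)]
      by (simp only: free_map_rels upd[OF add(2)])
  next
    case (smult v j c x)
    then show ?thesis
      using rels_intros(2)[OF act_closed[OF g smult(1)] smult(2) \<rho>_closed[OF smult(2) g smult(3)], of c]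
        LinearCombinations.module_hom_smult[OF \<rho>_hom[OF smult(2) g] _ smult(3), of c]
      by (simp add: free_map_rels upd[OF smult(2)] del: fun_upd_apply)
  qed
  then show ?thesis using R_sub_U by blast
qed

lemma tensor_linear_rep: "linear_rep G (tensor_space J V) (tensor_action J V \<rho>)"
  unfolding tensor_space_eq tensor_action_def
  by (rule linear_rep_quotient[OF G act_closed act_mult act_one act_rels])

lemma tensor_action_pure:
  assumes g: "g \<in> carrier G" and x: "\<And>j. j \<in> J \<Longrightarrow> x j \<in> carrier (V j)"
  shows "tensor_action J V \<rho> g (pure_tensor J V x) = pure_tensor J V (\<lambda>j. \<rho> j g (x j))"
proof -
  have "tensor_action J V \<rho> g (pure_tensor J V x) =
      tensor_null J V +>\<^bsub>F\<^esub> free_map (\<lambda>v. \<lambda>j\<in>J. \<rho> j g (v j)) (single (restrict x J))"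
    unfolding tensor_action_def pure_tensor_eq
    by (rule quot_map_free_coset[OF G act_closed act_mult act_one act_rels g]) (use x in auto)
  then show ?thesis by (simp add: pure_tensor_eq cong: restrict_cong)
qed

end

end

section \<open>Tensor products of induced representations\<close>

text \<open>A basis here is a set of vectors and would hide repetitions in the indexed family, so
  injectivity of \<open>e\<close> is a conclusion of its own. Tuples are encoded as extensional
  functions on \<open>{1..k}\<close>.\<close>

theorem proposition1p2p5:
  fixes d k :: nat
    and W :: "nat \<Rightarrow> (nat \<Rightarrow> nat) set"
    and \<chi> :: "nat \<Rightarrow> (nat \<Rightarrow> nat) \<Rightarrow> 'k::{alg_closed_field, field_char_0}"
    and I :: "nat \<Rightarrow> (nat \<Rightarrow> nat) set"
  assumes "d \<ge> 1" and "k \<ge> 1"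
    and "\<And>m. m \<in> {1..k} \<Longrightarrow> subgroup (W m) (sym_group d)"
    and "\<And>m. m \<in> {1..k} \<Longrightarrow> one_dim_char ((sym_group d)\<lparr>carrier := W m\<rparr>) (\<chi> m)"
    and "\<And>m. m \<in> {1..k} \<Longrightarrow> left_transversal (sym_group d) (W m) (I m)"
  shows
    "let G = sym_group d;
         V = (\<lambda>m. ind_space G (W m) (\<chi> m));
         T = tensor_space {1..k} V;
         \<rho> = tensor_action {1..k} V (\<lambda>m. ind_action G (W m) (\<chi> m));
         II = (\<Pi>\<^sub>E m\<in>{1..k}. I m);
         e = (\<lambda>i. pure_tensor {1..k} V (\<lambda>m. ind_vec G (W m) (\<chi> m) (i m)));
         s = (\<lambda>\<zeta> i. \<lambda>m\<in>{1..k}. trans_action G (W m) (I m) \<zeta> (i m));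
         \<beta> = (\<lambda>i \<zeta>. \<Prod>m\<in>{1..k}. trans_coeff G (W m) (\<chi> m) (I m) (i m) \<zeta>)
     in inj_on e II \<and> monomial_rep G T \<rho> (e ` II) \<and>
        (\<forall>\<zeta>\<in>carrier G. \<forall>i\<in>II. \<rho> \<zeta> (e i) = \<beta> i \<zeta> \<odot>\<^bsub>T\<^esub> e (s \<zeta> i))"
proof -
  define G where "G = sym_group d"
  define V where "V = (\<lambda>m. ind_space G (W m) (\<chi> m))"
  define T where "T = tensor_space {1..k} V"
  define \<rho> where "\<rho> = tensor_action {1..k} V (\<lambda>m. ind_action G (W m) (\<chi> m))"
  define II where "II = (\<Pi>\<^sub>E m\<in>{1..k}. I m)"
  define e where "e = (\<lambda>i. pure_tensor {1..k} V (\<lambda>m. ind_vec G (W m) (\<chi> m) (i m)))"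
  define s where "s = (\<lambda>\<zeta> i. \<lambda>m\<in>{1..k}. trans_action G (W m) (I m) \<zeta> (i m))"
  define \<beta> where "\<beta> = (\<lambda>i \<zeta>. \<Prod>m\<in>{1..k}. trans_coeff G (W m) (\<chi> m) (I m) (i m) \<zeta>)"
  have G: "group G" unfolding G_def by (rule sym_group_is_group)
  \<comment> \<open>Coordinates on the factors are sums over \<open>W m\<close>, so finiteness of
    the group has to be supplied.\<close>
  have "finite (carrier G)"
    using finite_permutations[of "{1..d}"] by (simp add: G_def sym_group_def)
  then have ind: "induced G (W m) (\<chi> m) (I m)" if "m \<in> {1..k}" for m
    using assms(3-5)[OF that] G
    by (intro induced.intro finite_group.intro finite_group_axioms.intro induced_axioms.intro)
      (simp_all add: G_def)
  have "\<exists>\<kappa>. coord_basis (V m) (I m) (ind_vec G (W m) (\<chi> m)) \<kappa>" if "m \<in> {1..k}" for m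
    using induced.ind_coord_basis[OF ind[OF that]] by (simp add: V_def)
  \<comment> \<open>Gathers the separately existing coordinates into one family that the tensor
    product can multiply.\<close>
  then obtain \<kappa> where
    \<kappa>: "\<And>m. m \<in> {1..k} \<Longrightarrow> coord_basis (V m) (I m) (ind_vec G (W m) (\<chi> m)) (\<kappa> m)"
    by metis
  have rep: "linear_rep G (V m) (ind_action G (W m) (\<chi> m))" if "m \<in> {1..k}" for m
    using induced.ind_linear_rep[OF ind[OF that]] by (simp add: V_def)
  have vec: "ind_vec G (W m) (\<chi> m) i \<in> carrier (V m)" if "m \<in> {1..k}" "i \<in> I m" for m i
    using \<kappa>[OF that(1)] that(2) by (auto simp: coord_basis_def)
  interpret T: tensor_product "{1..k}" V
    using \<kappa> by (intro tensor_product.intro) (simp_all add: coord_basis_def)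
  obtain \<kappa>' where \<kappa>': "coord_basis T II e \<kappa>'"
    using T.tensor_coord_basis[of I "\<lambda>m. ind_vec G (W m) (\<chi> m)" \<kappa>] \<kappa>
    unfolding T_def II_def e_def by blast
  have act: "\<rho> \<zeta> (e i) = \<beta> i \<zeta> \<odot>\<^bsub>T\<^esub> e (s \<zeta> i)" "\<beta> i \<zeta> \<noteq> 0" "s \<zeta> i \<in> II"
    if \<zeta>: "\<zeta> \<in> carrier G" and i: "i \<in> II" for \<zeta> i
  proof -
    have im: "i m \<in> I m" if "m \<in> {1..k}" for m using i that by (auto simp: II_def)
    note step = induced.ind_action_vec[OF ind \<zeta> im]
    show "s \<zeta> i \<in> II" using step(1) by (auto simp: s_def II_def)
    show "\<beta> i \<zeta> \<noteq> 0" using step(2) by (auto simp: \<beta>_def)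
    have "\<rho> \<zeta> (e i) = pure_tensor {1..k} V (\<lambda>m. ind_action G (W m) (\<chi> m) \<zeta> (ind_vec G (W m) (\<chi> m) (i m)))"
      unfolding \<rho>_def e_def by (rule T.tensor_action_pure[OF G rep \<zeta>]) (use vec im in auto)
    \<comment> \<open>\<open>s \<zeta> i\<close> agrees with the transversal actions on
      \<open>{1..k}\<close>. A pure tensor restricts its argument to that range, so agreement there
      is enough.\<close>
    also have "\<dots> = pure_tensor {1..k} V (\<lambda>m. trans_coeff G (W m) (\<chi> m) (I m) (i m) \<zeta> \<odot>\<^bsub>V m\<^esub>
        ind_vec G (W m) (\<chi> m) (s \<zeta> i m))"
      unfolding T.pure_tensor_eq using step(3)
      by (intro arg_cong[where f = T.cls] restrict_ext) (simp add: V_def s_def)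
    also have "\<dots> = \<beta> i \<zeta> \<odot>\<^bsub>T\<^esub> e (s \<zeta> i)"
      unfolding \<beta>_def T_def e_def
      by (rule T.pure_tensor_smult) (use vec PiE_mem[OF \<open>s \<zeta> i \<in> II\<close>[unfolded II_def]] in auto)
    finally show "\<rho> \<zeta> (e i) = \<beta> i \<zeta> \<odot>\<^bsub>T\<^esub> e (s \<zeta> i)" .
  qed
  have "linear_rep G T \<rho>"
    unfolding T_def \<rho>_def by (rule T.tensor_linear_rep[OF G rep])
  then have "monomial_rep G T \<rho> (e ` II)"
    unfolding monomial_rep_def using coord_basis_basis[OF \<kappa>'] act by blast
  with coord_basis_inj_on[OF \<kappa>'] act(1) show ?thesis
    unfolding Let_def G_def V_def T_def \<rho>_def II_def e_def s_def \<beta>_def by blast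
qed

end
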